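(* Let $G$ be a torus with Lie algebra $\mathfrak g$ and integral lattice $\mathbb Z_G\subset\mathfrak g$. Let $u_1,\dots,u_N\in\mathbb Z_G$ be primitive vectors spanning $\mathfrak g$ over $\mathbb R$, let $\lambda_1,\dots,\lambda_N\in\mathbb R$, and let $P=\{\eta\in\mathfrak g^*\mid \langle\eta,u_j\rangle-\lambda_j\ge 0,\ 1\le j\le N\}$. Assume that $P$ has non-empty interior $\mathring P$ and that the collection of inequalities defining $P$ is minimal (dropping any one of them gives a strictly bigger set). Let $M_P=\mathbb C^N/\!/_\nu K$ be the Kähler quotient with its $G$-action and moment map $\phi_P:M_P\to\mathfrak g^*$ described in the context. Then the Kähler form $\omega_P$ on the manifold $\mathring M_P:=\phi_P^{-1}(\mathring P)$ is $$\omega_P=\sqrt{-1}\,\partial\bar\partial\,\phi_P^*\Big(\sum_{j=1}^N\big(\lambda_j\log(u_j-\lambda_j)+u_j\big)\Big),$$ where $u_j$ is regarded as the function $\eta\mapsto\langle\eta,u_j\rangle$ on $\mathfrak g^*$.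
   Context: Construction of $M_P$. Let $A:\mathbb R^N\to\mathfrak g$ be the linear map with $A(e_i)=u_i$ ($e_i$ the standard basis, $e_i^*$ the dual basis of $(\mathbb R^N)^*$). It maps $\mathbb Z^N$ into $\mathbb Z_G$ and induces a surjective homomorphism $\bar A:\mathbb T^N=\mathbb R^N/\mathbb Z^N\to\mathfrak g/\mathbb Z_G=G$. Let $K=\ker\bar A$, a compact abelian (possibly disconnected) group with Lie algebra $\mathfrak k=\ker A$, let $B:\mathfrak k\to\mathbb R^N$ be the inclusion, and let $A^*,B^*$ be the dual maps. Put $\lambda=\sum_i\lambda_ie_i^*$, $\nu=B^*(-\lambda)\in\mathfrak k^*$, and let $\iota_\lambda:\mathfrak g^*\to(\mathbb R^N)^*$, $\iota_\lambda(\ell)=-\lambda+A^*(\ell)$, an affine embedding with image $(B^* )^{-1}(\nu)$. Equip $\mathbb C^N$ with the flat Kähler form $\sqrt{-1}\sum_j dz_j\wedge d\bar z_j=\sqrt{-1}\,\partial\bar\partial\|z\|^2$ and the standard $\mathbb T^N$-action, with moment map normalized as $\phi(z)=\sum_j|z_j|^2e_j^*$. The $K$-moment map is $\phi_K=B^*\circ\phi$. Set $M_P=\mathbb C^N/\!/_\nu K:=\phi_K^{-1}(\nu)/K$, a (possibly singular) Kähler quotient on which $G=\mathbb T^N/K$ acts. One has $\phi(\phi_K^{-1}(\nu))=\iota_\lambda(P)$. The restriction of $\phi$ to $\phi_K^{-1}(\nu)$ descends to $\bar\phi:M_P\to\iota_\lambda(\mathfrak g^* )$, and $\phi_P:=\iota_\lambda^{-1}\circ\bar\phi:M_P\to\mathfrak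 g^*$ is the moment map, with image $P$. The set $\mathring M_P=\phi_P^{-1}(\mathring P)$ equals $(\phi_K^{-1}(\nu)\cap(\mathbb C^\times)^N)/K=(\mathbb C^\times)^N/\!/_\nu K$. Here $K$ acts freely on $(\mathbb C^\times)^N$, and $\mathring M_P$ carries the usual reduced complex structure and reduced Kähler form $\omega_P$ (its pullback to $\phi_K^{-1}(\nu)\cap(\mathbb C^\times)^N$ is the restriction of the flat Kähler form). *)

theory Defs
  imports "HOL-Analysis.Analysis" "HOL-Library.Set_Algebras"
begin

text \<open>
  The torus \<open>G\<close> is presented by its Lie algebra, a finite-dimensional real vector space
  \<open>real ^ 'd\<close>, together with its integral lattice \<open>L\<close>, an arbitrary lattice of full rank, so that
  \<open>G\<close> is the quotient of \<open>real ^ 'd\<close> by \<open>L\<close>.  Dual spaces are spaces of (bounded) linear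
  functionals.  Quotients (tori, the space of orbits, tangent spaces of the space of orbits) are
  sets of equivalence classes.
\<close>

definition is_lattice :: "(real ^ 'd) set \<Rightarrow> bool" where
  "is_lattice L \<longleftrightarrow>
     (\<exists>B. independent B \<and> span B = UNIV \<and>
          L = {(\<Sum>b\<in>B. of_int (c b) *\<^sub>R b) | c :: real ^ 'd \<Rightarrow> int. True})"

definition primitive_in :: "(real ^ 'd) set \<Rightarrow> real ^ 'd \<Rightarrow> bool" where
  "primitive_in L v \<longleftrightarrow>
     v \<in> L \<and> v \<noteq> 0 \<and> (\<forall>w\<in>L. \<forall>m::int. v = of_int m *\<^sub>R w \<longrightarrow> m = 1 \<or> m = -1)"

definition polyhedron_of ::
  "('n \<Rightarrow> real ^ 'd) \<Rightarrow> ('n \<Rightarrow> real) \<Rightarrow> ((real ^ 'd) \<Rightarrow>\<^sub>L real) set" where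
  "polyhedron_of u lam = {\<eta>. \<forall>j. blinfun_apply \<eta> (u j) - lam j \<ge> 0}"


subsection \<open>The group \<open>K\<close> and its action\<close>

definition A_map :: "('n::finite \<Rightarrow> real ^ 'd) \<Rightarrow> (real ^ 'n) \<Rightarrow>\<^sub>L (real ^ 'd)" where
  "A_map u = Blinfun (\<lambda>t. \<Sum>j\<in>UNIV. (t $ j) *\<^sub>R u j)"

definition lie_K :: "('n::finite \<Rightarrow> real ^ 'd) \<Rightarrow> (real ^ 'n) set" where
  "lie_K u = {X. blinfun_apply (A_map u) X = 0}"

definition int_vectors :: "(real ^ 'n) set" where
  "int_vectors = {t. \<forall>j. t $ j \<in> \<int>}"

definition std_torus :: "(real ^ 'n) set set" where
  "std_torus = {t +o int_vectors | t. True}"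

definition A_bar ::
  "(real ^ 'd) set \<Rightarrow> ('n::finite \<Rightarrow> real ^ 'd) \<Rightarrow> (real ^ 'n) set \<Rightarrow> (real ^ 'd) set" where
  "A_bar L u c = (\<Union>t\<in>c. blinfun_apply (A_map u) t +o L)"

text \<open>The coset \<open>L\<close> is the neutral element of \<open>G\<close>.\<close>

definition K_group ::
  "(real ^ 'd) set \<Rightarrow> ('n::finite \<Rightarrow> real ^ 'd) \<Rightarrow> (real ^ 'n) set set" where
  "K_group L u = {c \<in> std_torus. A_bar L u c = L}"

text \<open>The choice of the representative \<open>t\<close> of the coset \<open>c\<close> does not matter.\<close>

definition torus_act :: "(real ^ 'n) set \<Rightarrow> complex ^ 'n \<Rightarrow> complex ^ 'n" where
  "torus_act c z = (let t = (SOME t. t \<in> c) in \<chi> j. cis (2 * pi * t $ j) * z $ j)"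

text \<open>The velocity at time 0 of the curve \<open>s \<mapsto> exp(2 pi i s X) z\<close>.\<close>

definition inf_act :: "real ^ 'n \<Rightarrow> complex ^ 'n \<Rightarrow> complex ^ 'n" where
  "inf_act X z = (\<chi> j. \<i> * complex_of_real (2 * pi * X $ j) * z $ j)"


subsection \<open>The quotient \<open>M\<^sub>P\<close> and its moment map\<close>

definition dual_basis :: "'n::finite \<Rightarrow> (real ^ 'n) \<Rightarrow>\<^sub>L real" where
  "dual_basis j = Blinfun (\<lambda>t. t $ j)"

definition moment :: "complex ^ 'n \<Rightarrow> (real ^ 'n) \<Rightarrow>\<^sub>L real" where
  "moment z = (\<Sum>j\<in>UNIV. (cmod (z $ j))\<^sup>2 *\<^sub>R dual_basis j)"

definition lam_covec :: "('n::finite \<Rightarrow> real) \<Rightarrow> (real ^ 'n) \<Rightarrow>\<^sub>L real" where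
  "lam_covec lam = (\<Sum>j\<in>UNIV. lam j *\<^sub>R dual_basis j)"

text \<open>
  The dual of the inclusion of \<open>lie_K u\<close>: restriction of functionals.  An element of the dual
  of the subspace \<open>lie_K u\<close> is a function on it, encoded as an extensional function.
\<close>

definition B_dual ::
  "('n::finite \<Rightarrow> real ^ 'd) \<Rightarrow> ((real ^ 'n) \<Rightarrow>\<^sub>L real) \<Rightarrow> (real ^ 'n \<Rightarrow> real)" where
  "B_dual u \<xi> = restrict (blinfun_apply \<xi>) (lie_K u)"

definition level_set ::
  "('n::finite \<Rightarrow> real ^ 'd) \<Rightarrow> ('n \<Rightarrow> real) \<Rightarrow> (complex ^ 'n) set" where
  "level_set u lam = {z. B_dual u (moment z) = B_dual u (- lam_covec lam)}"

definition orbit_proj ::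
  "(real ^ 'd) set \<Rightarrow> ('n::finite \<Rightarrow> real ^ 'd) \<Rightarrow> complex ^ 'n \<Rightarrow> (complex ^ 'n) set" where
  "orbit_proj L u z = (\<lambda>c. torus_act c z) ` K_group L u"

definition M_quot ::
  "(real ^ 'd) set \<Rightarrow> ('n::finite \<Rightarrow> real ^ 'd) \<Rightarrow> ('n \<Rightarrow> real) \<Rightarrow> (complex ^ 'n) set set" where
  "M_quot L u lam = orbit_proj L u ` level_set u lam"

definition iota ::
  "('n::finite \<Rightarrow> real ^ 'd) \<Rightarrow> ('n \<Rightarrow> real) \<Rightarrow> ((real ^ 'd) \<Rightarrow>\<^sub>L real) \<Rightarrow> ((real ^ 'n) \<Rightarrow>\<^sub>L real)" where
  "iota u lam \<eta> = - lam_covec lam + (\<eta> o\<^sub>L A_map u)"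

text \<open>\<open>moment\<close> is constant on each orbit, so the choice of a point of \<open>p\<close> does not matter.\<close>

definition moment_P ::
  "('n::finite \<Rightarrow> real ^ 'd) \<Rightarrow> ('n \<Rightarrow> real) \<Rightarrow> (complex ^ 'n) set \<Rightarrow> ((real ^ 'd) \<Rightarrow>\<^sub>L real)" where
  "moment_P u lam p = inv (iota u lam) (moment (SOME z. z \<in> p))"

definition M_open ::
  "(real ^ 'd) set \<Rightarrow> ('n::finite \<Rightarrow> real ^ 'd) \<Rightarrow> ('n \<Rightarrow> real) \<Rightarrow> (complex ^ 'n) set set" where
  "M_open L u lam = {p \<in> M_quot L u lam. moment_P u lam p \<in> interior (polyhedron_of u lam)}"


subsection \<open>Tangent spaces, reduced complex structure and reduced form\<close>

text \<open>The tangent space of the level set: the kernel of the differential of the \<open>K\<close>-moment map.\<close>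

definition level_tangent :: "('n::finite \<Rightarrow> real ^ 'd) \<Rightarrow> complex ^ 'n \<Rightarrow> (complex ^ 'n) set" where
  "level_tangent u z = {v. B_dual u (frechet_derivative moment (at z) v) = B_dual u 0}"

text \<open>
  The differential of \<open>orbit_proj\<close> at \<open>z\<close>.  A tangent vector of the quotient is an equivalence
  class of pairs (point of the level set, tangent vector there) modulo the action of \<open>K\<close> and
  modulo vectors tangent to the orbits; torus elements act linearly, so that the differential
  of \<open>torus_act c\<close> is \<open>torus_act c\<close>.
\<close>

definition d_proj ::
  "(real ^ 'd) set \<Rightarrow> ('n::finite \<Rightarrow> real ^ 'd) \<Rightarrow> complex ^ 'n \<Rightarrow> complex ^ 'n \<Rightarrow>
   ((complex ^ 'n) \<times> (complex ^ 'n)) set" where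
  "d_proj L u z v =
     {(torus_act c z, torus_act c (v + inf_act X z)) | c X. c \<in> K_group L u \<and> X \<in> lie_K u}"

definition M_tangent ::
  "(real ^ 'd) set \<Rightarrow> ('n::finite \<Rightarrow> real ^ 'd) \<Rightarrow> (complex ^ 'n) set \<Rightarrow>
   ((complex ^ 'n) \<times> (complex ^ 'n)) set set" where
  "M_tangent L u p = {d_proj L u z v | z v. z \<in> p \<and> v \<in> level_tangent u z}"

text \<open>
  The horizontal space at \<open>z\<close> is the orthogonal complement, in the tangent space of the level
  set, of the tangent space of the orbit.  It is a complex subspace, which \<open>d_proj\<close> maps
  isomorphically to the tangent space of the quotient; the reduced complex structure is the one
  for which this isomorphism is complex linear.
\<close>

definition horizontal :: "('n::finite \<Rightarrow> real ^ 'd) \<Rightarrow> complex ^ 'n \<Rightarrow> (complex ^ 'n) set" where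
  "horizontal u z = {v \<in> level_tangent u z. \<forall>X\<in>lie_K u. inf_act X z \<bullet> v = 0}"

definition J_red ::
  "(real ^ 'd) set \<Rightarrow> ('n::finite \<Rightarrow> real ^ 'd) \<Rightarrow> ('n \<Rightarrow> real) \<Rightarrow>
   ((complex ^ 'n) \<times> (complex ^ 'n)) set \<Rightarrow> ((complex ^ 'n) \<times> (complex ^ 'n)) set" where
  "J_red L u lam a =
     (THE b. \<exists>z\<in>level_set u lam. \<exists>v\<in>horizontal u z.
        a = d_proj L u z v \<and> b = d_proj L u z (\<i> *s v))"

text \<open>
  The form \<open>i sum_j dz_j \<and> d(cnj z_j)\<close>, with \<open>(\<alpha> \<and> \<beta>)(v, w) = \<alpha>(v) \<beta>(w) - \<alpha>(w) \<beta>(v)\<close>.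
  Forms are regarded as complex valued.
\<close>

definition flat_form :: "complex ^ 'n \<Rightarrow> complex ^ 'n \<Rightarrow> complex" where
  "flat_form v w = \<i> * (\<Sum>j\<in>UNIV. v $ j * cnj (w $ j) - w $ j * cnj (v $ j))"

definition omega_red ::
  "(real ^ 'd) set \<Rightarrow> ('n::finite \<Rightarrow> real ^ 'd) \<Rightarrow> ('n \<Rightarrow> real) \<Rightarrow>
   ((complex ^ 'n) \<times> (complex ^ 'n)) set \<Rightarrow> ((complex ^ 'n) \<times> (complex ^ 'n)) set \<Rightarrow> complex" where
  "omega_red L u lam a b =
     (THE r. \<exists>z\<in>level_set u lam. \<exists>v\<in>level_tangent u z. \<exists>w\<in>level_tangent u z.
        a = d_proj L u z v \<and> b = d_proj L u z w \<and> r = flat_form v w)"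


subsection \<open>Holomorphic coordinates and the operator \<open>\<partial>\<partial>\<close>-bar\<close>

definition wirt :: "'d::finite \<Rightarrow> (complex ^ 'd \<Rightarrow> complex) \<Rightarrow> complex ^ 'd \<Rightarrow> complex" where
  "wirt k f w = (frechet_derivative f (at w) (axis k 1)
                 - \<i> * frechet_derivative f (at w) (axis k \<i>)) / 2"

definition wirt_bar :: "'d::finite \<Rightarrow> (complex ^ 'd \<Rightarrow> complex) \<Rightarrow> complex ^ 'd \<Rightarrow> complex" where
  "wirt_bar k f w = (frechet_derivative f (at w) (axis k 1)
                     + \<i> * frechet_derivative f (at w) (axis k \<i>)) / 2"

definition ddbar ::
  "(complex ^ 'd \<Rightarrow> complex) \<Rightarrow> complex ^ 'd \<Rightarrow> complex ^ 'd \<Rightarrow> complex ^ 'd \<Rightarrow> complex" where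
  "ddbar f w x y =
     (\<Sum>k\<in>UNIV. \<Sum>l\<in>UNIV. wirt k (wirt_bar l f) w * (x $ k * cnj (y $ l) - y $ k * cnj (x $ l)))"

text \<open>
  A local holomorphic parametrization \<open>U \<rightarrow> M_open L u lam\<close>, \<open>w \<mapsto> orbit_proj L u (s w)\<close>, given
  through a lift \<open>s\<close> to the level set: an injective \<open>C\<^sup>1\<close> map whose differential is at each point a
  complex linear isomorphism onto the tangent space.  Since \<open>orbit_proj\<close> is a principal bundle
  over \<open>M_open L u lam\<close>, every holomorphic parametrization locally has such a lift; since the
  reduced complex structure is integrable, \<open>C\<^sup>1\<close> and complex linearity of the differential
  amount to holomorphy.  The complex dimension of \<open>M_open L u lam\<close> is that of \<open>complex ^ 'd\<close>.
\<close>

definition hol_param ::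
  "(real ^ 'd) set \<Rightarrow> ('n::finite \<Rightarrow> real ^ 'd) \<Rightarrow> ('n \<Rightarrow> real) \<Rightarrow>
   (complex ^ 'd) set \<Rightarrow> (complex ^ 'd \<Rightarrow> complex ^ 'n) \<Rightarrow> bool" where
  "hol_param L u lam U s \<longleftrightarrow>
     open U \<and>
     s ` U \<subseteq> level_set u lam \<and>
     (\<lambda>w. orbit_proj L u (s w)) ` U \<subseteq> M_open L u lam \<and>
     inj_on (\<lambda>w. orbit_proj L u (s w)) U \<and>
     (\<forall>w\<in>U. s differentiable (at w)) \<and>
     (\<forall>x. continuous_on U (\<lambda>w. frechet_derivative s (at w) x)) \<and>
     (\<forall>w\<in>U. bij_betw (\<lambda>x. d_proj L u (s w) (frechet_derivative s (at w) x))
              UNIV (M_tangent L u (orbit_proj L u (s w)))) \<and>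
     (\<forall>w\<in>U. \<forall>x. d_proj L u (s w) (frechet_derivative s (at w) (\<i> *s x)) =
              J_red L u lam (d_proj L u (s w) (frechet_derivative s (at w) x)))"

text \<open>
  The form \<open>\<partial>\<partial>\<close>-bar of a function \<open>f\<close> on \<open>M_open L u lam\<close>, evaluated on two tangent vectors
  at the same point: the value computed in holomorphic coordinates around that point.
\<close>

definition M_ddbar ::
  "(real ^ 'd) set \<Rightarrow> ('n::finite \<Rightarrow> real ^ 'd) \<Rightarrow> ('n \<Rightarrow> real) \<Rightarrow>
   ((complex ^ 'n) set \<Rightarrow> complex) \<Rightarrow>
   ((complex ^ 'n) \<times> (complex ^ 'n)) set \<Rightarrow> ((complex ^ 'n) \<times> (complex ^ 'n)) set \<Rightarrow> complex" where
  "M_ddbar L u lam f a b =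
     (THE r. \<exists>U s. hol_param L u lam U s \<and>
        (\<exists>w\<in>U. \<exists>x y.
           a = d_proj L u (s w) (frechet_derivative s (at w) x) \<and>
           b = d_proj L u (s w) (frechet_derivative s (at w) y) \<and>
           r = ddbar (\<lambda>w'. f (orbit_proj L u (s w'))) w x y))"

end

theory Submission
  imports Defs "HOL-Complex_Analysis.Cauchy_Integral_Formula"
begin

text \<open>
  Over the interior of the polyhedron all coordinates of the points of the level set are nonzero,
  and dividing by \<open>K\<close> can be done with logarithms: the multivalued map
  \<open>z \<mapsto> \<Sum>j. log (z\<^sub>j) u\<^sub>j\<close> with values in the complexified Lie algebra is unchanged, up to
  constants, by \<open>K\<close>.  Its differential is \<open>log_diff\<close>.  It kills the vertical vectors, and on the
  tangent space of the level set it kills nothing else (\<open>level_tangent_log_diff_0_imp_vertical\<close>).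
  So it identifies each tangent space of the quotient with \<open>complex ^ 'd\<close>, and under this
  identification the reduced complex structure is multiplication by \<open>\<i>\<close> (\<open>J_red_d_proj\<close>).  In other
  words, \<open>\<Sum>j. log (z\<^sub>j) u\<^sub>j\<close> is a holomorphic coordinate \<open>h\<close> of the quotient.

  Write \<open>l\<^sub>j = \<langle>\<eta>, u\<^sub>j\<rangle> - \<lambda>\<^sub>j = \<bar>z\<^sub>j\<bar>\<^sup>2\<close> for the value \<open>\<eta>\<close> of the moment map.  Then
  \<open>Re h = 1/2 \<Sum>j. log l\<^sub>j u\<^sub>j\<close>, that is, \<open>\<eta>\<close> and \<open>Re h\<close> are related by a Legendre transformation.
  Since \<open>(\<lambda>\<^sub>j / l\<^sub>j + 1) dl\<^sub>j = \<langle>\<eta>, u\<^sub>j\<rangle> d log l\<^sub>j\<close>, the potential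
  \<open>F = \<Sum>j. \<lambda>\<^sub>j log l\<^sub>j + \<langle>\<eta>, u\<^sub>j\<rangle>\<close> satisfies \<open>dF = 2 \<langle>\<eta>, d Re h\<rangle>\<close>.  As \<open>h\<close> is holomorphic, its
  antiholomorphic differential is \<open>\<langle>\<eta>, d cnj h\<rangle>\<close>, and \<open>\<i> \<partial>\<partial>\<close>-bar of \<open>F\<close> is the \<open>(1,1)\<close>-form
  \<open>\<i> \<langle>\<partial>\<eta>, d cnj h\<rangle>\<close>.  In terms of the logarithmic velocities \<open>v\<^sub>j / z\<^sub>j\<close> of two tangent vectors,
  both this form and the flat form become the same sum of products of real and imaginary parts
  weighted by \<open>\<bar>z\<^sub>j\<bar>\<^sup>2\<close> (\<open>flat_form_S\<close>, \<open>ddbar_potential\<close>).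

  The operator \<open>\<partial>\<partial>\<close>-bar on the quotient is defined through all holomorphic parametrizations, which
  are only assumed to be \<open>C\<^sup>1\<close>.  So the computation is made along an arbitrary one
  (\<open>hol_param_ddbar\<close>); the second derivatives of \<open>h\<close> which it needs come from Cauchy's integral
  formula (\<open>partial_derivative_complex_differentiable\<close>).  That every point lies in the image of some
  parametrization is shown by inverting the Legendre map with the inverse function theorem
  (\<open>hol_param_exists\<close>).
\<close>


section \<open>Complex linear derivatives\<close>

lemma complex_linear_scale:
  fixes f :: "complex ^ 'd \<Rightarrow> complex"
  assumes "linear f" and J: "\<And>x. f (\<i> *s x) = \<i> * f x"
  shows "f (c *s x) = c * f x"
proof -
  have "c *s x = Re c *\<^sub>R x + Im c *\<^sub>R (\<i> *s x)"
    by (simp add: vec_eq_iff complex_eq_iff)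
  then have "f (c *s x) = of_real (Re c) * f x + of_real (Im c) * (\<i> * f x)"
    using assms by (simp add: linear_add linear_scale scaleR_conv_of_real[where 'a=complex])
  also have "\<dots> = c * f x"
    by (simp add: complex_eq_iff algebra_simps)
  finally show ?thesis .
qed

lemma linear_scalar_mult_left: "linear (\<lambda>c::complex. c *s (e :: complex ^ 'd))"
  by (rule linearI) (simp_all add: vec_eq_iff distrib_right)

lemma norm_scalar_mult: "norm (c *s x) = cmod c * norm x" for x :: "complex ^ 'd"
  by (simp add: norm_vec_def norm_mult L2_set_right_distrib)

text \<open>
  On the complex line through \<open>w\<close> in direction \<open>e\<close> this is Cauchy's formula for the derivative of a
  function of one variable.  With the circle parametrized, \<open>w\<close> becomes a parameter of an integral
  over a fixed interval, so that the formula can be differentiated in \<open>w\<close>.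
\<close>

lemma Cauchy_partial_derivative:
  fixes h :: "complex ^ 'd::finite \<Rightarrow> complex"
  assumes r: "0 < r"
    and der: "\<And>\<zeta>. \<zeta> \<in> cball 0 r \<Longrightarrow> (h has_derivative h' (w + \<zeta> *s e)) (at (w + \<zeta> *s e))"
    and J: "\<And>\<zeta> x. \<zeta> \<in> cball 0 r \<Longrightarrow> h' (w + \<zeta> *s e) (\<i> *s x) = \<i> * h' (w + \<zeta> *s e) x"
  shows "((\<lambda>t. h (w + (r * exp (2 * of_real pi * \<i> * of_real t)) *s e) / (r * exp (2 * of_real pi * \<i> * of_real t)))
            has_integral h' w e) {0..1}"
proof -
  define \<phi> where "\<phi> \<zeta> = h (w + \<zeta> *s e)" for \<zeta>
  have d: "(\<phi> has_field_derivative h' (w + \<zeta> *s e) e) (at \<zeta>)" if "\<zeta> \<in> cball 0 r" for \<zeta>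
  proof -
    have "((\<lambda>\<zeta>. w + \<zeta> *s e) has_derivative (\<lambda>v. v *s e)) (at \<zeta>)"
      using linear_imp_has_derivative[OF linear_scalar_mult_left[of e], of "at \<zeta>"]
      by (auto intro!: derivative_eq_intros)
    from has_derivative_compose[OF this der[OF that]]
    have "(\<phi> has_derivative (\<lambda>v. h' (w + \<zeta> *s e) (v *s e))) (at \<zeta>)"
      by (simp add: \<phi>_def[abs_def])
    moreover have "h' (w + \<zeta> *s e) (v *s e) = h' (w + \<zeta> *s e) e * v" for v
      using complex_linear_scale[OF has_derivative_linear[OF der[OF that]] J[OF that], of v e]
      by simp
    ultimately show ?thesis
      by (simp add: has_field_derivative_def)
  qed
  have "((\<lambda>u. \<phi> u / (u - 0) ^ Suc 1) has_contour_integral ((2 * pi * \<i>) / fact 1 * (deriv ^^ 1) \<phi> 0)) (circlepath 0 r)"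
  proof (rule Cauchy_has_contour_integral_higher_derivative_circlepath)
    show "continuous_on (cball 0 r) \<phi>"
      by (intro continuous_at_imp_continuous_on ballI DERIV_isCont[OF d])
    show "\<phi> holomorphic_on ball 0 r"
      by (metis (no_types, lifting) ball_subset_cball d field_differentiable_at_within field_differentiable_def holomorphic_on_def subsetD)
  qed (use r in auto)
  moreover have "deriv \<phi> 0 = h' w e"
    using DERIV_imp_deriv[OF d[of 0]] r by simp
  ultimately have "((\<lambda>u. \<phi> u / u\<^sup>2) has_contour_integral (2 * pi * \<i> * h' w e)) (circlepath 0 r)"
    by (simp add: power2_eq_square)
  then have "((\<lambda>t. \<phi> (circlepath 0 r t) / (circlepath 0 r t)\<^sup>2 * vector_derivative (circlepath 0 r) (at t within {0..1}))
       has_integral (2 * pi * \<i> * h' w e)) {0..1}"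
    by (simp add: has_contour_integral_def)
  then have "((\<lambda>t. \<phi> (circlepath 0 r t) / (circlepath 0 r t)\<^sup>2 * vector_derivative (circlepath 0 r) (at t within {0..1}) * (1 / (2 * pi * \<i>)))
       has_integral (2 * pi * \<i> * h' w e * (1 / (2 * pi * \<i>)))) {0..1}"
    by (rule has_integral_mult_left)
  then have "((\<lambda>t. \<phi> (circlepath 0 r t) / (circlepath 0 r t)\<^sup>2 * vector_derivative (circlepath 0 r) (at t within {0..1}) * (1 / (2 * pi * \<i>)))
       has_integral h' w e) {0..1}"
    by simp
  then show ?thesis
  proof (rule has_integral_eq[rotated])
    fix t :: real assume "t \<in> {0..1}"
    then show "\<phi> (circlepath 0 r t) / (circlepath 0 r t)\<^sup>2 * vector_derivative (circlepath 0 r) (at t within {0..1}) * (1 / (2 * pi * \<i>))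
      = h (w + (r * exp (2 * of_real pi * \<i> * of_real t)) *s e) / (r * exp (2 * of_real pi * \<i> * of_real t))"
      using r by (subst vector_derivative_circlepath01) (auto simp: \<phi>_def circlepath power2_eq_square field_simps)
  qed
qed

text \<open>
  A \<open>C\<^sup>1\<close> function with complex linear differential has complex differentiable partial derivatives:
  the Cauchy integral for the partial derivative may be differentiated under the integral sign,
  and each of the integrands then has a complex linear differential.
\<close>

lemma partial_derivative_complex_differentiable:
  fixes h :: "complex ^ 'd::finite \<Rightarrow> complex"
  assumes U: "open U" "w0 \<in> U"
    and der: "\<And>w. w \<in> U \<Longrightarrow> (h has_derivative h' w) (at w)"
    and J: "\<And>w x. w \<in> U \<Longrightarrow> h' w (\<i> *s x) = \<i> * h' w x"
    and cont: "\<And>x. continuous_on U (\<lambda>w. h' w x)"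
  obtains D where "((\<lambda>w. h' w e) has_derivative D) (at w0)" "\<And>x. D (\<i> *s x) = \<i> * D x"
proof -
  obtain r0 where r0: "0 < r0" "cball w0 r0 \<subseteq> U"
    using U open_contains_cball by blast
  \<comment> \<open>The discs of radius \<open>r\<close> in direction \<open>e\<close> around the points of \<open>ball w0 (r0/2)\<close> stay in \<open>cball w0 r0\<close>;
    the summand 1 covers the case that \<open>e\<close> is zero.\<close>
  define r where "r = r0 / 2 / (norm e + 1)"
  have r: "0 < r" "r * norm e \<le> r0 / 2"
    using r0 by (auto simp: r_def field_simps add_nonneg_pos add_pos_nonneg)
  have inU: "w + \<zeta> *s e \<in> U" if "w \<in> ball w0 (r0/2)" "\<zeta> \<in> cball 0 r" for w \<zeta>
  proof -
    have "norm (\<zeta> *s e) \<le> r0 / 2"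
      using that(2) r mult_right_mono[of "cmod \<zeta>" r "norm e"] by (simp add: norm_scalar_mult)
    then have "dist w0 (w + \<zeta> *s e) \<le> r0"
      using that(1) norm_triangle_ineq4[of "w0 - w" "\<zeta> *s e"] by (simp add: dist_norm algebra_simps)
    then show ?thesis using r0(2) by auto
  qed
  define c where "c t = of_real r * exp (2 * of_real pi * \<i> * of_real t)" for t :: real
  have c_in: "c t \<in> cball 0 r" "c t \<noteq> 0" for t
    using r by (auto simp: c_def norm_mult)
  define f where "f w t = h (w + c t *s e) / c t" for w t
  define fx where "fx w t = Blinfun (\<lambda>x. h' (w + c t *s e) x / c t)" for w t
  have fx: "blinfun_apply (fx w t) = (\<lambda>x. h' (w + c t *s e) x / c t)" if "w \<in> ball w0 (r0/2)" for w t
    unfolding fx_def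
    using has_derivative_bounded_linear[OF der[OF inU[OF that c_in(1)[of t]]]]
    by (intro bounded_linear_Blinfun_apply bounded_linear_compose[OF bounded_linear_divide])
  have int: "(f w has_integral h' w e) {0..1}" if "w \<in> ball w0 (r0/2)" for w
    unfolding f_def c_def
    by (rule Cauchy_partial_derivative[OF r(1)]) (rule der[OF inU[OF that]] J[OF inU[OF that]], assumption)+
  have cont_c: "continuous_on (ball w0 (r0/2) \<times> cbox 0 1) (\<lambda>(w,t). w + c t *s e)"
    unfolding c_def vector_scalar_mult_def split_beta
    by (intro continuous_intros continuous_on_vec_lambda)
  have leib: "((\<lambda>w. integral (cbox 0 1) (f w)) has_derivative integral (cbox 0 1) (fx w0)) (at w0 within ball w0 (r0/2))"
  proof (rule leibniz_rule)
    fix w :: "complex ^ 'd" and t :: real assume w: "w \<in> ball w0 (r0/2)" and t: "t \<in> cbox 0 1"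
    show "((\<lambda>x. f x t) has_derivative blinfun_apply (fx w t)) (at w within ball w0 (r0/2))"
      unfolding f_def fx[OF w]
    proof (rule has_derivative_at_withinI)
      have "((\<lambda>w. w + c t *s e) has_derivative (\<lambda>x. x)) (at w)"
        by (auto intro!: derivative_eq_intros)
      from has_derivative_compose[OF this der[OF inU[OF w c_in(1)[of t]]]]
      show "((\<lambda>x. h (x + c t *s e) / c t) has_derivative (\<lambda>x. h' (w + c t *s e) x / c t)) (at w)"
        using c_in(2)[of t] by (auto simp: divide_inverse intro: has_derivative_mult_left)
    qed
  next
    fix w assume "w \<in> ball w0 (r0/2)"
    then show "f w integrable_on cbox 0 1"
      using int by auto
  next
    show "continuous_on (ball w0 (r0/2) \<times> cbox 0 1) (\<lambda>(x, t). fx x t)"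
    proof (rule continuous_on_blinfun_componentwise)
      fix i :: "complex ^ 'd"
      have "continuous_on (ball w0 (r0/2) \<times> cbox 0 1) (\<lambda>p. h' (case p of (w,t) \<Rightarrow> w + c t *s e) i / c (snd p))"
        using c_in(2)
        by (intro continuous_on_divide continuous_on_compose2[OF cont cont_c])
           (auto simp: c_def intro!: continuous_intros inU[unfolded c_def] c_in[unfolded c_def])
      then show "continuous_on (ball w0 (r0/2) \<times> cbox 0 1) (\<lambda>x. blinfun_apply (case x of (x, t) \<Rightarrow> fx x t) i)"
        by (rule continuous_on_eq) (auto simp: fx)
    qed
  qed (use r0 in auto)
  have w0: "w0 \<in> ball w0 (r0/2)" using r0 by simp
  have fxint: "fx w0 integrable_on {0..1}"
  proof -
    have "continuous_on {0..1} (fx w0)"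
    proof (rule continuous_on_blinfun_componentwise)
      fix i :: "complex ^ 'd"
      have cc: "continuous_on {0..1} (\<lambda>t. w0 + c t *s e)"
        unfolding c_def vector_scalar_mult_def by (intro continuous_intros continuous_on_vec_lambda)
      show "continuous_on {0..1} (\<lambda>x. blinfun_apply (fx w0 x) i)"
        unfolding fx[OF w0] using c_in(2)
        by (intro continuous_on_divide continuous_on_compose2[OF cont cc])
           (auto simp: c_def intro!: continuous_intros inU[OF w0, unfolded c_def] c_in[unfolded c_def])
    qed
    then show ?thesis by (rule integrable_continuous_real)
  qed
  show thesis
  proof
    have "((\<lambda>w. integral {0..1} (f w)) has_derivative integral {0..1} (fx w0)) (at w0)"
      using leib w0 by (simp add: at_within_open[OF w0])
    then show "((\<lambda>w. h' w e) has_derivative integral {0..1} (fx w0)) (at w0)"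
      by (rule has_derivative_transform_within_open[of _ _ _ _ "ball w0 (r0/2)"])
         (use int w0 in \<open>auto intro: integral_unique\<close>)
    show "blinfun_apply (integral {0..1} (fx w0)) (\<i> *s x) = \<i> * blinfun_apply (integral {0..1} (fx w0)) x" for x
      unfolding blinfun_apply_integral[OF fxint] fx[OF w0]
      by (simp add: J[OF inU[OF w0 c_in(1)]] flip: integral_mult_right)
  qed
qed

text \<open>
  The Wirtinger derivatives of a real linear form are the coefficients of its complex linear part.
\<close>

lemma wirtinger_expansion:
  fixes \<epsilon> :: "complex ^ 'd::finite \<Rightarrow> complex"
  assumes "linear \<epsilon>"
  shows "(\<Sum>k\<in>UNIV. (\<epsilon> (axis k 1) - \<i> * \<epsilon> (axis k \<i>)) / 2 * x $ k) = (\<epsilon> x - \<i> * \<epsilon> (\<i> *s x)) / 2"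
proof -
  have x: "x = (\<Sum>k\<in>UNIV. Re (x $ k) *\<^sub>R axis k 1 + Im (x $ k) *\<^sub>R axis k \<i>)"
    by (simp add: vec_eq_iff axis_def complex_eq_iff sum.distrib if_distrib cong: if_cong)
  have ix: "\<i> *s x = (\<Sum>k\<in>UNIV. Re (x $ k) *\<^sub>R axis k \<i> - Im (x $ k) *\<^sub>R axis k 1)"
    by (simp add: vec_eq_iff axis_def complex_eq_iff sum_subtractf if_distrib cong: if_cong)
  have e: "\<epsilon> x = (\<Sum>k\<in>UNIV. Re (x $ k) * \<epsilon> (axis k 1) + Im (x $ k) * \<epsilon> (axis k \<i>))"
    by (subst x) (simp add: linear_sum[OF assms] linear_add[OF assms] linear_scale[OF assms] scaleR_conv_of_real[where 'a=complex])
  have ie: "\<epsilon> (\<i> *s x) = (\<Sum>k\<in>UNIV. Re (x $ k) * \<epsilon> (axis k \<i>) - Im (x $ k) * \<epsilon> (axis k 1))"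
    by (subst ix) (simp add: linear_sum[OF assms] linear_diff[OF assms] linear_scale[OF assms] scaleR_conv_of_real[where 'a=complex])
  have "(\<Sum>k\<in>UNIV. (\<epsilon> (axis k 1) - \<i> * \<epsilon> (axis k \<i>)) / 2 * x $ k)
      = (\<Sum>k\<in>UNIV. ((Re (x $ k) * \<epsilon> (axis k 1) + Im (x $ k) * \<epsilon> (axis k \<i>))
            - \<i> * (Re (x $ k) * \<epsilon> (axis k \<i>) - Im (x $ k) * \<epsilon> (axis k 1))) / 2)"
    by (intro sum.cong refl) (simp add: complex_eq_iff algebra_simps add_divide_distrib diff_divide_distrib)
  also have "\<dots> = (\<epsilon> x - \<i> * \<epsilon> (\<i> *s x)) / 2"
    unfolding e ie sum_divide_distrib[symmetric] sum_subtractf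
    by (simp add: sum_distrib_left right_diff_distrib sum_subtractf)
  finally show ?thesis .
qed

section \<open>Moment maps and the torus action in coordinates\<close>

lemma A_map_apply: "blinfun_apply (A_map u) t = (\<Sum>j\<in>UNIV. (t $ j) *\<^sub>R u j)"
proof -
  have "linear (\<lambda>t. \<Sum>j\<in>UNIV. (t $ j) *\<^sub>R u j)"
    by (rule linearI) (simp_all add: scaleR_add_left sum.distrib scaleR_sum_right)
  then show ?thesis
    unfolding A_map_def by (simp add: bounded_linear_Blinfun_apply linear_conv_bounded_linear)
qed

lemma dual_basis_apply: "blinfun_apply (dual_basis j) t = t $ j"
  unfolding dual_basis_def by (simp add: bounded_linear_Blinfun_apply bounded_linear_vec_nth)

lemma moment_apply: "blinfun_apply (moment z) t = (\<Sum>j\<in>UNIV. (cmod (z $ j))\<^sup>2 * t $ j)"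
  unfolding moment_def by (simp add: blinfun.sum_left blinfun.scaleR_left dual_basis_apply)

lemma lam_covec_apply: "blinfun_apply (lam_covec lam) t = (\<Sum>j\<in>UNIV. lam j * t $ j)"
  unfolding lam_covec_def by (simp add: blinfun.sum_left blinfun.scaleR_left dual_basis_apply)

lemma iota_apply:
  "blinfun_apply (iota u lam \<eta>) t = (\<Sum>j\<in>UNIV. (blinfun_apply \<eta> (u j) - lam j) * t $ j)"
  unfolding iota_def
  by (simp add: blinfun.add_left blinfun.minus_left lam_covec_apply A_map_apply blinfun.sum_right
      blinfun.scaleR_right blinfun.diff_left right_diff_distrib sum_subtractf mult.commute)

lemma mem_lie_K: "X \<in> lie_K u \<longleftrightarrow> (\<Sum>j\<in>UNIV. (X $ j) *\<^sub>R u j) = 0"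
  by (simp add: lie_K_def A_map_apply)

lemma subspace_lie_K: "subspace (lie_K u)"
  unfolding lie_K_def by (rule linear_subspace_kernel) (simp add: blinfun.bounded_linear_right bounded_linear.linear)

lemma B_dual_eq_iff: "B_dual u \<xi> = B_dual u \<xi>' \<longleftrightarrow> (\<forall>X\<in>lie_K u. blinfun_apply \<xi> X = blinfun_apply \<xi>' X)"
  unfolding B_dual_def by (auto simp: restrict_def fun_eq_iff split: if_splits)

lemma mem_level_set:
  "z \<in> level_set u lam \<longleftrightarrow> (\<forall>X\<in>lie_K u. (\<Sum>j\<in>UNIV. ((cmod (z $ j))\<^sup>2 + lam j) * X $ j) = 0)"
proof -
  have "(\<Sum>j\<in>UNIV. ((cmod (z $ j))\<^sup>2 + lam j) * X $ j)
      = blinfun_apply (moment z) X - blinfun_apply (- lam_covec lam) X" for X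
    by (simp add: moment_apply lam_covec_apply blinfun.minus_left distrib_right sum.distrib)
  then show ?thesis
    by (simp add: level_set_def B_dual_eq_iff)
qed

lemma has_derivative_moment:
  "(moment has_derivative (\<lambda>v. \<Sum>j\<in>UNIV. (2 * (z $ j \<bullet> v $ j)) *\<^sub>R dual_basis j)) (at z)"
  unfolding moment_def[abs_def] power2_norm_eq_inner
  by (auto intro!: derivative_eq_intros bounded_linear_imp_has_derivative[OF bounded_linear_vec_nth]
      simp: inner_commute)

lemma mem_level_tangent:
  "v \<in> level_tangent u z \<longleftrightarrow> (\<forall>X\<in>lie_K u. (\<Sum>j\<in>UNIV. (z $ j \<bullet> v $ j) * X $ j) = 0)"
proof -
  have "frechet_derivative moment (at z) v = (\<Sum>j\<in>UNIV. (2 * (z $ j \<bullet> v $ j)) *\<^sub>R dual_basis j)"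
    by (simp flip: frechet_derivative_at[OF has_derivative_moment])
  then have "blinfun_apply (frechet_derivative moment (at z) v) X = 2 * (\<Sum>j\<in>UNIV. (z $ j \<bullet> v $ j) * X $ j)" for X
    by (simp add: blinfun.sum_left blinfun.scaleR_left dual_basis_apply sum_distrib_left mult.assoc)
  then show ?thesis
    by (simp add: level_tangent_def B_dual_eq_iff)
qed

lemma subspace_level_tangent: "subspace (level_tangent u z)"
proof (rule subspaceI)
  fix v w assume "v \<in> level_tangent u z" "w \<in> level_tangent u z"
  then show "v + w \<in> level_tangent u z"
    by (simp add: mem_level_tangent inner_add_right distrib_right sum.distrib)
next
  fix c v assume v: "v \<in> level_tangent u z"
  have "(\<Sum>j\<in>UNIV. (z $ j \<bullet> (c *\<^sub>R v) $ j) * X $ j) = c * (\<Sum>j\<in>UNIV. (z $ j \<bullet> v $ j) * X $ j)" for X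
    by (simp add: sum_distrib_left mult.assoc)
  with v show "c *\<^sub>R v \<in> level_tangent u z"
    unfolding mem_level_tangent by (metis mult_zero_right)
qed (simp add: mem_level_tangent)

lemma inf_act_nth: "inf_act X z $ j = \<i> * complex_of_real (2 * pi * X $ j) * z $ j"
  by (simp add: inf_act_def)

lemma linear_inf_act: "linear (\<lambda>X. inf_act X z)"
  by (rule linearI) (simp_all add: vec_eq_iff inf_act_nth complex_eq_iff algebra_simps)

text \<open>
  A vertical vector moves each coordinate orthogonally to itself, so all the moduli are stationary.
\<close>

lemma inf_act_level_tangent: "inf_act X z \<in> level_tangent u z"
  unfolding mem_level_tangent inf_act_nth inner_complex_def by (simp add: algebra_simps)


text \<open>
  The action of the class of \<open>t\<close> in the standard torus.  With representatives instead of cosets the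
  action is given by a formula without a choice.
\<close>

definition phase_act :: "real ^ 'n \<Rightarrow> complex ^ 'n \<Rightarrow> complex ^ 'n" where
  "phase_act t z = (\<chi> j. cis (2 * pi * t $ j) * z $ j)"

lemma phase_act_nth: "phase_act t z $ j = cis (2 * pi * t $ j) * z $ j"
  by (simp add: phase_act_def)

lemma phase_act_phase_act: "phase_act s (phase_act t z) = phase_act (s + t) z"
  by (simp add: vec_eq_iff phase_act_nth cis_mult distrib_left flip: mult.assoc)

lemma phase_act_zero: "phase_act 0 z = z"
  by (simp add: vec_eq_iff phase_act_nth)

lemma phase_act_add: "phase_act t (v + w) = phase_act t v + phase_act t w"
  by (simp add: vec_eq_iff phase_act_nth distrib_left)

lemma phase_act_scalar: "phase_act t (c *s v) = c *s phase_act t v"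
  by (simp add: vec_eq_iff phase_act_nth mult_ac)

lemma phase_act_inf_act: "phase_act t (inf_act X z) = inf_act X (phase_act t z)"
  by (simp add: vec_eq_iff phase_act_nth inf_act_nth mult_ac)

lemma cmod_phase_act: "cmod (phase_act t z $ j) = cmod (z $ j)"
  by (simp add: phase_act_nth norm_mult)

lemma inner_complex_Re: "a \<bullet> b = Re (cnj a * b)"
  by (simp add: inner_complex_def)

lemma inner_phase_act_nth: "phase_act t z $ j \<bullet> phase_act t v $ j = z $ j \<bullet> v $ j"
proof -
  have "cnj (cis a) * cis a = 1" for a
    by (simp add: cis_cnj cis_mult)
  moreover have "cnj (cis a * x) * (cis a * y) = (cnj (cis a) * cis a) * (cnj x * y)" for a x y
    by (simp only: complex_cnj_mult mult_ac)
  ultimately show ?thesis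
    by (simp only: phase_act_nth inner_complex_Re mult_1)
qed

lemma phase_act_level_tangent: "phase_act t v \<in> level_tangent u (phase_act t z) \<longleftrightarrow> v \<in> level_tangent u z"
  by (simp add: mem_level_tangent inner_phase_act_nth)

lemma phase_act_eq_self:
  assumes "t \<in> int_vectors"
  shows "phase_act t z = z"
proof -
  have "cis (2 * pi * t $ j) = 1" for j
    using assms by (intro cis_multiple_2pi) (simp add: int_vectors_def)
  then show ?thesis by (simp add: vec_eq_iff phase_act_nth)
qed

lemma torus_act_coset: "torus_act (t +o int_vectors) z = phase_act t z"
proof -
  have "0 \<in> (int_vectors :: (real ^ 'n) set)"
    by (simp add: int_vectors_def)
  then have "\<exists>s. s \<in> t +o int_vectors"
    by (auto simp: elt_set_plus_def)
  then have "(SOME s. s \<in> t +o int_vectors) \<in> t +o int_vectors"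
    by (rule someI_ex)
  then obtain b where "b \<in> int_vectors" "(SOME s. s \<in> t +o int_vectors) = t + b"
    by (auto simp: elt_set_plus_def)
  then show ?thesis
    using phase_act_phase_act[of t b z] phase_act_eq_self[of b z]
    by (simp add: torus_act_def Let_def flip: phase_act_def)
qed

section \<open>The logarithmic differential\<close>

text \<open>
  The differential at \<open>z\<close> of the multivalued map \<open>z \<mapsto> \<Sum>j. log (z\<^sub>j) u\<^sub>j\<close>, which is locally the
  quotient map by the complexification of \<open>K\<close> on the points without zero coordinates.
\<close>

definition log_diff :: "('n::finite \<Rightarrow> real ^ 'd) \<Rightarrow> complex ^ 'n \<Rightarrow> complex ^ 'n \<Rightarrow> complex ^ 'd" where
  "log_diff u z v = (\<chi> m. \<Sum>j\<in>UNIV. v $ j / z $ j * complex_of_real (u j $ m))"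

lemma log_diff_nth: "log_diff u z v $ m = (\<Sum>j\<in>UNIV. v $ j / z $ j * complex_of_real (u j $ m))"
  by (simp add: log_diff_def)

lemma log_diff_add: "log_diff u z (v + w) = log_diff u z v + log_diff u z w"
  by (simp add: vec_eq_iff log_diff_nth add_divide_distrib distrib_right sum.distrib)

lemma log_diff_diff: "log_diff u z (v - w) = log_diff u z v - log_diff u z w"
  by (simp add: vec_eq_iff log_diff_nth diff_divide_distrib left_diff_distrib sum_subtractf)

lemma log_diff_scalar: "log_diff u z (c *s v) = c *s log_diff u z v"
  by (simp add: vec_eq_iff log_diff_nth sum_distrib_left mult_ac)

lemma log_diff_phase_act: "log_diff u (phase_act t z) (phase_act t v) = log_diff u z v"
  by (simp add: vec_eq_iff log_diff_nth phase_act_nth)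

lemma Re_log_diff: "Re (log_diff u z v $ m) = (\<Sum>j\<in>UNIV. Re (v $ j / z $ j) *\<^sub>R u j) $ m"
  by (simp add: log_diff_nth del: times_divide_eq_left)

lemma Im_log_diff: "Im (log_diff u z v $ m) = (\<Sum>j\<in>UNIV. Im (v $ j / z $ j) *\<^sub>R u j) $ m"
  by (simp add: log_diff_nth del: times_divide_eq_left)

lemma inner_eq_norm_Re_divide:
  fixes z v :: complex
  assumes "z \<noteq> 0"
  shows "z \<bullet> v = (cmod z)\<^sup>2 * Re (v / z)"
proof -
  have "cnj z * v = complex_of_real ((cmod z)\<^sup>2) * (v / z)"
    using assms unfolding complex_norm_square by (simp add: field_simps)
  then have "cnj z * v = (cmod z)\<^sup>2 *\<^sub>R (v / z)"
    by (simp only: scaleR_conv_of_real)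
  then show ?thesis
    by (simp only: inner_complex_Re scaleR_complex.sel)
qed

text \<open>
  The logarithmic velocity of the flow of \<open>X\<close> is \<open>2 pi \<i> X\<close>, and \<open>X\<close> is a linear relation among
  the \<open>u\<^sub>j\<close>.
\<close>

lemma log_diff_inf_act:
  assumes "X \<in> lie_K u" and nz: "\<And>j. z $ j \<noteq> 0"
  shows "log_diff u z (inf_act X z) = 0"
proof -
  have "(\<Sum>j\<in>UNIV. X $ j * u j $ m) = 0" for m
    using assms(1) by (auto simp: mem_lie_K vec_eq_iff)
  moreover have "log_diff u z (inf_act X z) $ m = \<i> * of_real (2 * pi) * of_real (\<Sum>j\<in>UNIV. X $ j * u j $ m)" for m
    using nz by (simp add: log_diff_nth inf_act_nth sum_distrib_left mult_ac)
  ultimately show ?thesis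
    by (simp add: vec_eq_iff)
qed

text \<open>
  The real part \<open>Y\<close> of \<open>v / z\<close> is a relation among the \<open>u\<^sub>j\<close>, so it lies in \<open>lie_K u\<close>, and tangency
  to the level set may be tested on \<open>Y\<close> itself.  This gives a weighted sum of the squares of its
  components, which therefore vanish: \<open>v / z\<close> is imaginary, as for a vertical vector.
\<close>

lemma level_tangent_log_diff_0_imp_vertical:
  fixes u :: "'n::finite \<Rightarrow> real ^ 'd"
  assumes nz: "\<And>j. z $ j \<noteq> 0" and v: "v \<in> level_tangent u z" and 0: "log_diff u z v = 0"
  obtains X where "X \<in> lie_K u" "v = inf_act X z"
proof
  define Y :: "real ^ 'n" where "Y = (\<chi> j. Re (v $ j / z $ j))"
  define X :: "real ^ 'n" where "X = (\<chi> j. Im (v $ j / z $ j) / (2 * pi))"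
  have "Y \<in> lie_K u"
    unfolding mem_lie_K vec_eq_iff Y_def vec_lambda_beta Re_log_diff[symmetric] by (simp add: 0)
  then have "(\<Sum>j\<in>UNIV. (z $ j \<bullet> v $ j) * Y $ j) = 0"
    using v by (simp add: mem_level_tangent)
  then have "(\<Sum>j\<in>UNIV. (cmod (z $ j))\<^sup>2 * (Y $ j)\<^sup>2) = 0"
    using nz by (simp add: inner_eq_norm_Re_divide Y_def power2_eq_square mult.assoc)
  then have Y0: "Y $ j = 0" for j
    using nz by (subst (asm) sum_nonneg_eq_0_iff) auto
  show "v = inf_act X z"
    unfolding vec_eq_iff
  proof
    fix j
    have "v $ j / z $ j = \<i> * of_real (Im (v $ j / z $ j))"
      using Y0[of j] by (simp add: complex_eq_iff Y_def)
    then show "v $ j = inf_act X z $ j"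
      using nz[of j] by (simp add: inf_act_nth X_def field_simps)
  qed
  show "X \<in> lie_K u"
  proof -
    have "(\<Sum>j\<in>UNIV. Im (v $ j / z $ j) *\<^sub>R u j) = 0"
      unfolding vec_eq_iff Im_log_diff[symmetric] by (simp add: 0)
    then have "(1 / (2 * pi)) *\<^sub>R (\<Sum>j\<in>UNIV. Im (v $ j / z $ j) *\<^sub>R u j) = 0"
      by simp
    then show ?thesis
      by (simp add: mem_lie_K X_def scaleR_sum_right)
  qed
qed

section \<open>Lattices\<close>

lemma lattice_zero: "is_lattice L \<Longrightarrow> 0 \<in> L"
  unfolding is_lattice_def by (auto intro: exI[of _ "\<lambda>_. 0"])

lemma lattice_scale_int:
  assumes "is_lattice L" "x \<in> L"
  shows "of_int n *\<^sub>R x \<in> L"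
proof -
  obtain B where L: "L = {(\<Sum>b\<in>B. of_int (c b) *\<^sub>R b) | c. True}"
    using assms(1) by (auto simp: is_lattice_def)
  then obtain c where "x = (\<Sum>b\<in>B. of_int (c b) *\<^sub>R b)"
    using assms(2) by auto
  then have "of_int n *\<^sub>R x = (\<Sum>b\<in>B. of_int (n * c b) *\<^sub>R b)"
    by (simp add: scaleR_sum_right)
  then show ?thesis
    unfolding L by (intro CollectI exI[of _ "\<lambda>b. n * c b"]) simp
qed

lemma lattice_add:
  assumes "is_lattice L" "x \<in> L" "y \<in> L"
  shows "x + y \<in> L"
proof -
  obtain B where L: "L = {(\<Sum>b\<in>B. of_int (c b) *\<^sub>R b) | c. True}"
    using assms(1) by (auto simp: is_lattice_def)
  then obtain c d where "x = (\<Sum>b\<in>B. of_int (c b) *\<^sub>R b)" "y = (\<Sum>b\<in>B. of_int (d b) *\<^sub>R b)"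
    using assms(2,3) by auto
  then have "x + y = (\<Sum>b\<in>B. of_int (c b + d b) *\<^sub>R b)"
    by (simp add: scaleR_add_left sum.distrib)
  then show ?thesis
    unfolding L by (intro CollectI exI[of _ "\<lambda>b. c b + d b"]) simp
qed

lemma lattice_minus: "is_lattice L \<Longrightarrow> x \<in> L \<Longrightarrow> - x \<in> L"
  using lattice_scale_int[of L x "-1"] by simp

lemma lattice_sum:
  assumes "is_lattice L" "\<And>i. i \<in> I \<Longrightarrow> f i \<in> L"
  shows "sum f I \<in> L"
  using assms(2) by (induction I rule: infinite_finite_induct) (auto intro: lattice_zero lattice_add assms(1))

text \<open>
  Coordinates with respect to a basis of the lattice are bounded linear functionals, and on the
  lattice they are integers.
\<close>

lemma lattice_discrete:
  fixes L :: "(real ^ 'd::finite) set"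
  assumes "is_lattice L"
  obtains e where "0 < e" "\<And>x. x \<in> L \<Longrightarrow> norm x < e \<Longrightarrow> x = 0"
proof -
  obtain B where B: "independent B" and L: "L = {(\<Sum>b\<in>B. of_int (c b) *\<^sub>R b) | c. True}"
    using assms by (auto simp: is_lattice_def)
  have fin: "finite B"
    using B by (rule independent_imp_finite)
  have "\<exists>K>0. \<forall>c::real ^ 'd \<Rightarrow> int. \<bar>of_int (c a)\<bar> \<le> norm (\<Sum>b\<in>B. of_int (c b) *\<^sub>R b) * K" if a: "a \<in> B" for a
  proof -
    obtain g where g: "linear g" "\<And>b. b \<in> B \<Longrightarrow> g b = (if b = a then 1 else 0 :: real)"
      using linear_independent_extend[OF B, of "\<lambda>b. if b = a then 1 else 0"] by metis
    obtain K where K: "0 < K" "\<And>x. norm (g x) \<le> norm x * K"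
      using g(1) bounded_linear.pos_bounded linear_conv_bounded_linear by metis
    have "g (\<Sum>b\<in>B. of_int (c b) *\<^sub>R b) = of_int (c a)" for c :: "real ^ 'd \<Rightarrow> int"
      using fin a by (simp add: linear_sum[OF g(1)] linear_scale[OF g(1)] g(2) if_distrib sum.delta cong: sum.cong if_cong)
    with K have "\<bar>of_int (c a)\<bar> \<le> norm (\<Sum>b\<in>B. of_int (c b) *\<^sub>R b) * K" for c :: "real ^ 'd \<Rightarrow> int"
      using K(2)[of "\<Sum>b\<in>B. of_int (c b) *\<^sub>R b"] by simp
    with K(1) show ?thesis by blast
  qed
  then have "\<exists>K. \<forall>a\<in>B. 0 < K a \<and> (\<forall>c::real ^ 'd \<Rightarrow> int. \<bar>of_int (c a)\<bar> \<le> norm (\<Sum>b\<in>B. of_int (c b) *\<^sub>R b) * K a)"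
    by (intro bchoice) auto
  then obtain K where K: "\<And>a. a \<in> B \<Longrightarrow> 0 < K a"
    "\<And>a c. a \<in> B \<Longrightarrow> \<bar>of_int (c a)\<bar> \<le> norm (\<Sum>b\<in>B. of_int ((c :: real ^ 'd \<Rightarrow> int) b) *\<^sub>R b) * K a"
    by blast
  define e where "e = 1 / (1 + sum K B)"
  have S: "0 \<le> sum K B" using K(1) by (simp add: sum_nonneg less_imp_le)
  show thesis
  proof
    show "0 < e" using S by (simp add: e_def)
    fix x assume "x \<in> L" and x: "norm x < e"
    then obtain c where c: "x = (\<Sum>b\<in>B. of_int (c b) *\<^sub>R b)" by (auto simp: L)
    have "c a = 0" if a: "a \<in> B" for a
    proof -
      have "K a \<le> sum K B"
        using a fin K(1) by (intro member_le_sum) (auto intro: less_imp_le)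
      then have "norm x * K a \<le> norm x * (1 + sum K B)"
        by (intro mult_left_mono) auto
      also have "\<dots> < 1"
        using x S by (simp add: e_def field_simps)
      finally have "\<bar>of_int (c a)\<bar> < (1::real)"
        using K(2)[OF a, of c] by (simp add: c)
      then show ?thesis by linarith
    qed
    then show "x = 0" by (simp add: c)
  qed
qed

section \<open>Tangent vectors, complex structure and form of the quotient\<close>

text \<open>
  The representatives in \<open>real ^ 'n\<close> of the elements of \<open>K\<close>.
\<close>

definition K_lift :: "(real ^ 'd) set \<Rightarrow> ('n::finite \<Rightarrow> real ^ 'd) \<Rightarrow> (real ^ 'n) set" where
  "K_lift L u = {t. (\<Sum>j\<in>UNIV. (t $ j) *\<^sub>R u j) \<in> L}"

locale toric_data =
  fixes L :: "(real ^ 'd::finite) set" and u :: "'n::finite \<Rightarrow> real ^ 'd"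
  assumes lattice: "is_lattice L"
    and u_in: "u j \<in> L"
    and u_nonzero: "u j \<noteq> 0"
    and span_u: "span (range u) = UNIV"
begin

lemma K_lift_zero: "0 \<in> K_lift L u"
  by (simp add: K_lift_def lattice_zero[OF lattice])

lemma K_lift_add: "s \<in> K_lift L u \<Longrightarrow> t \<in> K_lift L u \<Longrightarrow> s + t \<in> K_lift L u"
  by (simp add: K_lift_def scaleR_add_left sum.distrib lattice_add[OF lattice])

lemma K_lift_minus: "t \<in> K_lift L u \<Longrightarrow> - t \<in> K_lift L u"
  using lattice_minus[OF lattice] by (simp add: K_lift_def sum_negf)

lemma int_vectors_K_lift: "t \<in> int_vectors \<Longrightarrow> t \<in> K_lift L u"
  unfolding K_lift_def
  by (auto simp: int_vectors_def Ints_def intro!: lattice_sum[OF lattice])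
     (metis lattice lattice_scale_int rangeE u_in)

lemma A_bar_coset: "A_bar L u (t +o int_vectors) = L \<longleftrightarrow> t \<in> K_lift L u"
proof
  assume eq: "A_bar L u (t +o int_vectors) = L"
  have "t \<in> t +o int_vectors"
    by (auto simp: elt_set_plus_def int_vectors_def intro: bexI[of _ 0])
  moreover have "blinfun_apply (A_map u) t \<in> blinfun_apply (A_map u) t +o L"
    using lattice_zero[OF lattice] by (auto simp: elt_set_plus_def intro: bexI[of _ 0])
  ultimately have "blinfun_apply (A_map u) t \<in> A_bar L u (t +o int_vectors)"
    by (auto simp: A_bar_def)
  then show "t \<in> K_lift L u"
    by (simp add: eq K_lift_def A_map_apply)
next
  assume t: "t \<in> K_lift L u"
  have "blinfun_apply (A_map u) s +o L = L" if "s \<in> t +o int_vectors" for s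
  proof -
    have "s \<in> K_lift L u"
      using that t by (auto simp: elt_set_plus_def intro: K_lift_add int_vectors_K_lift)
    then have s: "blinfun_apply (A_map u) s \<in> L"
      by (simp add: K_lift_def A_map_apply)
    have "x \<in> blinfun_apply (A_map u) s +o L" if "x \<in> L" for x
      using lattice_add[OF lattice that lattice_minus[OF lattice s]]
      by (auto simp: elt_set_plus_def intro: bexI[of _ "x - blinfun_apply (A_map u) s"])
    then show ?thesis
      using s by (auto simp: elt_set_plus_def intro: lattice_add[OF lattice])
  qed
  moreover have "t \<in> t +o int_vectors"
    by (auto simp: elt_set_plus_def int_vectors_def intro: bexI[of _ 0])
  ultimately show "A_bar L u (t +o int_vectors) = L"
    by (auto simp: A_bar_def)
qed

lemma K_group_eq: "K_group L u = (\<lambda>t. t +o int_vectors) ` K_lift L u"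
proof -
  have "K_group L u = {t +o int_vectors | t. A_bar L u (t +o int_vectors) = L}"
    by (auto simp: K_group_def std_torus_def)
  then show ?thesis
    by (auto simp only: A_bar_coset)
qed

lemma orbit_proj_eq: "orbit_proj L u z = (\<lambda>t. phase_act t z) ` K_lift L u"
  by (simp add: orbit_proj_def K_group_eq image_image torus_act_coset)

lemma d_proj_eq:
  "d_proj L u z v = {(phase_act t z, phase_act t (v + inf_act X z)) | t X. t \<in> K_lift L u \<and> X \<in> lie_K u}"
proof -
  have "d_proj L u z v = (\<Union>c\<in>K_group L u. {(torus_act c z, torus_act c (v + inf_act X z)) | X. X \<in> lie_K u})"
    by (auto simp: d_proj_def)
  also have "\<dots> = (\<Union>t\<in>K_lift L u. {(phase_act t z, phase_act t (v + inf_act X z)) | X. X \<in> lie_K u})"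
    by (simp add: K_group_eq torus_act_coset)
  finally show ?thesis by auto
qed

lemma zero_lie_K: "0 \<in> lie_K u"
  by (simp add: mem_lie_K)

lemma self_orbit: "z \<in> orbit_proj L u z"
  unfolding orbit_proj_eq using K_lift_zero by (force simp: phase_act_zero)

lemma inf_act_zero: "inf_act 0 z = 0"
  by (simp add: vec_eq_iff inf_act_nth)

lemma self_d_proj: "(z, v) \<in> d_proj L u z v"
proof -
  have "(z, v) = (phase_act 0 z, phase_act 0 (v + inf_act 0 z))"
    by (simp add: phase_act_zero inf_act_zero)
  then show ?thesis
    unfolding d_proj_eq using K_lift_zero zero_lie_K by blast
qed

lemma orbit_proj_phase_act:
  assumes t: "t \<in> K_lift L u"
  shows "orbit_proj L u (phase_act t z) = orbit_proj L u z"
proof -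
  have sub: "orbit_proj L u (phase_act t z) \<subseteq> orbit_proj L u z" if "t \<in> K_lift L u" for t z
    unfolding orbit_proj_eq using K_lift_add that by (auto simp: phase_act_phase_act)
  have "orbit_proj L u (phase_act (- t) (phase_act t z)) \<subseteq> orbit_proj L u (phase_act t z)"
    by (rule sub[OF K_lift_minus[OF t]])
  then show ?thesis
    using sub[OF t, of z] by (simp add: phase_act_phase_act phase_act_zero)
qed

lemma orbit_proj_eq_iff: "orbit_proj L u z = orbit_proj L u z' \<longleftrightarrow> (\<exists>t\<in>K_lift L u. z' = phase_act t z)"
  using self_orbit[of z'] orbit_proj_phase_act by (auto simp: orbit_proj_eq[of z])

lemma d_proj_move:
  assumes t: "t \<in> K_lift L u" and X: "X \<in> lie_K u"
  shows "d_proj L u (phase_act t z) (phase_act t (v + inf_act X z)) = d_proj L u z v"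
proof -
  have sub: "d_proj L u (phase_act t z) (phase_act t (v + inf_act X z)) \<subseteq> d_proj L u z v"
    if t: "t \<in> K_lift L u" and X: "X \<in> lie_K u" for t X z v
  proof
    fix p assume "p \<in> d_proj L u (phase_act t z) (phase_act t (v + inf_act X z))"
    then obtain s Y where s: "s \<in> K_lift L u" and Y: "Y \<in> lie_K u"
      and p: "p = (phase_act s (phase_act t z), phase_act s (phase_act t (v + inf_act X z) + inf_act Y (phase_act t z)))"
      by (auto simp: d_proj_eq)
    have "p = (phase_act (s + t) z, phase_act (s + t) (v + inf_act (X + Y) z))"
      by (simp add: p linear_add[OF linear_inf_act] phase_act_add add.assoc
          flip: phase_act_phase_act phase_act_inf_act)
    then show "p \<in> d_proj L u z v"
      using K_lift_add[OF s t] subspace_add[OF subspace_lie_K X Y] by (auto simp: d_proj_eq)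
  qed
  define z' v' where "z' = phase_act t z" and "v' = phase_act t (v + inf_act X z)"
  have "phase_act (- t) z' = z"
    by (simp add: z'_def phase_act_phase_act phase_act_zero)
  moreover have "phase_act (- t) (v' + inf_act (- X) z') = v"
    unfolding v'_def z'_def phase_act_inf_act[symmetric] phase_act_add[symmetric]
    by (simp add: phase_act_phase_act phase_act_zero linear_neg[OF linear_inf_act])
  ultimately have "d_proj L u z v \<subseteq> d_proj L u z' v'"
    using sub[OF K_lift_minus[OF t] subspace_neg[OF subspace_lie_K X], of z' v'] by simp
  then show ?thesis
    using sub[OF t X, of z v] by (auto simp: z'_def v'_def)
qed

lemma d_proj_eq_iff:
  "d_proj L u z v = d_proj L u z' v' \<longleftrightarrow>
     (\<exists>t\<in>K_lift L u. \<exists>X\<in>lie_K u. z' = phase_act t z \<and> v' = phase_act t (v + inf_act X z))"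
proof
  assume "d_proj L u z v = d_proj L u z' v'"
  then have "(z', v') \<in> d_proj L u z v"
    using self_d_proj by simp
  then show "\<exists>t\<in>K_lift L u. \<exists>X\<in>lie_K u. z' = phase_act t z \<and> v' = phase_act t (v + inf_act X z)"
    by (auto simp: d_proj_eq)
qed (auto simp: d_proj_move)

text \<open>
  By this the tangent space of the quotient at a point without zero coordinates is read off in
  \<open>complex ^ 'd\<close> through \<open>log_diff\<close>.
\<close>

lemma d_proj_eq_iff_log_diff:
  assumes nz: "\<And>j. z $ j \<noteq> 0" and v: "v \<in> level_tangent u z" and v': "v' \<in> level_tangent u z"
  shows "d_proj L u z v = d_proj L u z v' \<longleftrightarrow> log_diff u z v = log_diff u z v'"
proof
  assume "d_proj L u z v = d_proj L u z v'"
  then obtain t X where X: "X \<in> lie_K u" and z: "z = phase_act t z" and v'_eq: "v' = phase_act t (v + inf_act X z)"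
    by (auto simp: d_proj_eq_iff)
  have "log_diff u z v' = log_diff u (phase_act t z) (phase_act t (v + inf_act X z))"
    using z v'_eq by simp
  then show "log_diff u z v = log_diff u z v'"
    by (simp add: log_diff_phase_act log_diff_add log_diff_inf_act[OF X nz])
next
  assume "log_diff u z v = log_diff u z v'"
  then have "log_diff u z (v' - v) = 0"
    by (simp add: log_diff_diff)
  then obtain X where X: "X \<in> lie_K u" and "v' - v = inf_act X z"
    using level_tangent_log_diff_0_imp_vertical[OF nz subspace_diff[OF subspace_level_tangent v' v]] by blast
  then have "v + inf_act X z = v'"
    by (metis add_diff_cancel_left' add.commute diff_add_cancel)
  then show "d_proj L u z v = d_proj L u z v'"
    using d_proj_move[OF K_lift_zero X, of z v] by (simp add: phase_act_zero)
qed

lemma mem_M_tangent: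
  "a \<in> M_tangent L u (orbit_proj L u z) \<longleftrightarrow> (\<exists>v\<in>level_tangent u z. a = d_proj L u z v)"
proof
  assume "a \<in> M_tangent L u (orbit_proj L u z)"
  then obtain t v where t: "t \<in> K_lift L u" and v: "v \<in> level_tangent u (phase_act t z)"
    and a: "a = d_proj L u (phase_act t z) v"
    by (auto simp: M_tangent_def orbit_proj_eq)
  have v_eq: "v = phase_act t (phase_act (- t) v)"
    by (simp add: phase_act_phase_act phase_act_zero)
  then have "phase_act (- t) v \<in> level_tangent u z"
    using v by (metis phase_act_level_tangent)
  moreover have "a = d_proj L u z (phase_act (- t) v)"
    using d_proj_move[OF t zero_lie_K, of z "phase_act (- t) v"] a v_eq by (simp add: inf_act_zero)
  ultimately show "\<exists>v\<in>level_tangent u z. a = d_proj L u z v"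
    by blast
qed (use self_orbit in \<open>auto simp: M_tangent_def\<close>)

text \<open>
  The inner product of \<open>v\<close> with \<open>\<i> z\<^sub>j\<close> is minus that of \<open>\<i> v\<close> with \<open>z\<^sub>j\<close>, so orthogonality of \<open>v\<close> to
  the orbit is tangency of \<open>\<i> v\<close> to the level set.
\<close>

lemma horizontal_imag_tangent:
  assumes "v \<in> horizontal u z"
  shows "\<i> *s v \<in> level_tangent u z"
  unfolding mem_level_tangent
proof
  fix X assume X: "X \<in> lie_K u"
  have "inf_act X z $ j \<bullet> v $ j = - (2 * pi) * ((z $ j \<bullet> (\<i> *s v) $ j) * X $ j)" for j
    by (simp add: inf_act_nth inner_complex_def algebra_simps)
  then have "inf_act X z \<bullet> v = - (2 * pi) * (\<Sum>j\<in>UNIV. (z $ j \<bullet> (\<i> *s v) $ j) * X $ j)"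
    by (simp only: inner_vec_def sum_distrib_left)
  then show "(\<Sum>j\<in>UNIV. (z $ j \<bullet> (\<i> *s v) $ j) * X $ j) = 0"
    using assms X by (auto simp: horizontal_def)
qed

lemma horizontal_representative:
  assumes v: "v \<in> level_tangent u z"
  obtains X where "X \<in> lie_K u" "v + inf_act X z \<in> horizontal u z"
proof -
  define S where "S = (\<lambda>X. inf_act X z) ` lie_K u"
  have S: "subspace S"
    unfolding S_def by (rule linear_subspace_image[OF linear_inf_act subspace_lie_K])
  obtain y h where y: "y \<in> span S" and h: "\<And>w. w \<in> span S \<Longrightarrow> orthogonal h w" and vyh: "v = y + h"
    using orthogonal_subspace_decomp_exists[of S v] by metis
  have "y \<in> S"
    using y span_subspace[OF order_refl _ S] span_superset S by (metis span_eq_iff)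
  then obtain X where X: "X \<in> lie_K u" "y = inf_act X z"
    by (auto simp: S_def)
  have h_eq: "v + inf_act (- X) z = h"
    by (simp add: vyh X(2) linear_neg[OF linear_inf_act])
  have "h \<in> horizontal u z"
    unfolding horizontal_def
  proof (intro CollectI conjI ballI)
    show "h \<in> level_tangent u z"
      using subspace_add[OF subspace_level_tangent v inf_act_level_tangent] h_eq by metis
    fix Y assume "Y \<in> lie_K u"
    then have "inf_act Y z \<in> span S"
      by (auto simp: S_def intro: span_base)
    then show "inf_act Y z \<bullet> h = 0"
      using h by (metis orthogonal_def inner_commute)
  qed
  then show thesis
    using that[OF subspace_neg[OF subspace_lie_K X(1)]] h_eq by simp
qed

text \<open>
  Under \<open>log_diff\<close> the reduced complex structure is multiplication by \<open>\<i>\<close>: a horizontal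
  representative has the same \<open>log_diff\<close> as \<open>v\<close>, and \<open>log_diff\<close> is complex linear.  Comparing values
  of \<open>log_diff\<close> also shows that the choice of the horizontal representative does not matter.
\<close>

lemma J_red_d_proj:
  assumes z: "z \<in> level_set u lam" and nz: "\<And>j. z $ j \<noteq> 0"
    and v: "v \<in> level_tangent u z" and v': "v' \<in> level_tangent u z"
    and log: "log_diff u z v' = \<i> *s log_diff u z v"
  shows "J_red L u lam (d_proj L u z v) = d_proj L u z v'"
proof -
  have key: "d_proj L u z (\<i> *s (v + inf_act X z)) = d_proj L u z v'"
    if X: "X \<in> lie_K u" and "\<i> *s (v + inf_act X z) \<in> level_tangent u z" for X
    using that
    by (subst d_proj_eq_iff_log_diff[OF nz _ v'])
       (auto simp: log log_diff_scalar log_diff_add log_diff_inf_act[OF X nz])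
  show ?thesis
    unfolding J_red_def
  proof (rule the_equality)
    obtain X where X: "X \<in> lie_K u" and h: "v + inf_act X z \<in> horizontal u z"
      using horizontal_representative[OF v] by blast
    have "d_proj L u z v = d_proj L u z (v + inf_act X z)"
      using d_proj_move[OF K_lift_zero X, of z v] by (simp add: phase_act_zero)
    moreover have "d_proj L u z v' = d_proj L u z (\<i> *s (v + inf_act X z))"
      by (simp only: key[OF X horizontal_imag_tangent[OF h]])
    ultimately show "\<exists>z'\<in>level_set u lam. \<exists>w\<in>horizontal u z'.
        d_proj L u z v = d_proj L u z' w \<and> d_proj L u z v' = d_proj L u z' (\<i> *s w)"
      by (intro bexI[OF _ z] bexI[OF _ h] conjI)
  next
    fix b assume "\<exists>z'\<in>level_set u lam. \<exists>w\<in>horizontal u z'.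
        d_proj L u z v = d_proj L u z' w \<and> b = d_proj L u z' (\<i> *s w)"
    then obtain z' w where w: "w \<in> horizontal u z'" and eq: "d_proj L u z v = d_proj L u z' w"
      and b: "b = d_proj L u z' (\<i> *s w)"
      by blast
    from eq obtain t X where t: "t \<in> K_lift L u" and X: "X \<in> lie_K u"
      and z': "z' = phase_act t z" and w_eq: "w = phase_act t (v + inf_act X z)"
      by (auto simp: d_proj_eq_iff)
    have iw: "\<i> *s w = phase_act t (\<i> *s (v + inf_act X z))"
      by (simp only: w_eq phase_act_scalar)
    have "\<i> *s (v + inf_act X z) \<in> level_tangent u z"
      using horizontal_imag_tangent[OF w] by (simp only: iw z' phase_act_level_tangent)
    from key[OF X this] show "b = d_proj L u z v'"
      using d_proj_move[OF t zero_lie_K, of z "\<i> *s (v + inf_act X z)"]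
      by (simp only: b iw z' inf_act_zero add_0_right)
  qed
qed

end

lemma flat_form_add_left: "flat_form (v + v') w = flat_form v w + flat_form v' w"
  by (simp add: flat_form_def algebra_simps sum.distrib sum_subtractf)

lemma flat_form_swap: "flat_form w v = - flat_form v w"
  by (simp add: flat_form_def sum_subtractf algebra_simps)

lemma flat_form_phase_act: "flat_form (phase_act t v) (phase_act t w) = flat_form v w"
proof -
  have "cis a * cnj (cis a) = 1" for a
    by (simp add: cis_cnj cis_mult)
  moreover have "(cis a * x) * cnj (cis a * y) = (cis a * cnj (cis a)) * (x * cnj y)" for a x y
    by (simp only: complex_cnj_mult mult_ac)
  ultimately have "(cis a * x) * cnj (cis a * y) = x * cnj y" for a x y
    by (simp only: mult_1)
  then show ?thesis
    by (simp only: flat_form_def phase_act_nth)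
qed

text \<open>
  Contracting the flat form with the flow of \<open>X\<close> gives a multiple of the differential of the
  component \<open>X\<close> of the moment map, and this vanishes on the level set.
\<close>

lemma flat_form_inf_act:
  assumes "w \<in> level_tangent u z" "X \<in> lie_K u"
  shows "flat_form (inf_act X z) w = 0"
proof -
  have "inf_act X z $ j * cnj (w $ j) - w $ j * cnj (inf_act X z $ j)
      = \<i> * of_real (4 * pi) * of_real ((z $ j \<bullet> w $ j) * X $ j)" for j
    by (simp add: inf_act_nth inner_complex_def complex_eq_iff algebra_simps)
  then have "flat_form (inf_act X z) w = \<i> * (\<i> * of_real (4 * pi) * of_real (\<Sum>j\<in>UNIV. (z $ j \<bullet> w $ j) * X $ j))"
    by (simp only: flat_form_def sum_distrib_left of_real_sum)
  also have "(\<Sum>j\<in>UNIV. (z $ j \<bullet> w $ j) * X $ j) = 0"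
    using assms by (simp add: mem_level_tangent)
  finally show ?thesis by simp
qed

text \<open>
  The standard torus acts freely on the points without zero coordinates.
\<close>

lemma phase_act_eq_cong:
  assumes nz: "\<And>j. z $ j \<noteq> 0" and eq: "phase_act s z = phase_act t z"
  shows "phase_act s v = phase_act t v"
proof -
  have "cis (2 * pi * s $ j) = cis (2 * pi * t $ j)" for j
    using arg_cong[OF eq, of "\<lambda>x. x $ j"] nz[of j] by (simp add: phase_act_nth)
  then show ?thesis by (simp add: vec_eq_iff phase_act_nth)
qed

context toric_data begin

text \<open>
  The flat form is independent of the representatives because the torus acts by unitary maps and
  vertical vectors lie in the kernel of its restriction to the level set.  The two tangent vectors
  may be moved to another base point by different elements of \<open>K\<close>, but by freeness these act alike.
\<close>

lemma omega_red_d_proj: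
  assumes z: "z \<in> level_set u lam" and nz: "\<And>j. z $ j \<noteq> 0"
    and v: "v \<in> level_tangent u z" and w: "w \<in> level_tangent u z"
  shows "omega_red L u lam (d_proj L u z v) (d_proj L u z w) = flat_form v w"
  unfolding omega_red_def
proof (rule the_equality)
  show "\<exists>z'\<in>level_set u lam. \<exists>v'\<in>level_tangent u z'. \<exists>w'\<in>level_tangent u z'.
      d_proj L u z v = d_proj L u z' v' \<and> d_proj L u z w = d_proj L u z' w' \<and> flat_form v w = flat_form v' w'"
    by (intro bexI[OF _ z] bexI[OF _ v] bexI[OF _ w] conjI refl)
next
  fix r assume "\<exists>z'\<in>level_set u lam. \<exists>v'\<in>level_tangent u z'. \<exists>w'\<in>level_tangent u z'.
      d_proj L u z v = d_proj L u z' v' \<and> d_proj L u z w = d_proj L u z' w' \<and> r = flat_form v' w'"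
  then obtain z' v' w' where "d_proj L u z v = d_proj L u z' v'" "d_proj L u z w = d_proj L u z' w'"
    and r: "r = flat_form v' w'"
    by (elim bexE conjE) (rule that)
  then obtain s X t Y where X: "X \<in> lie_K u" and s: "z' = phase_act s z" "v' = phase_act s (v + inf_act X z)"
    and Y: "Y \<in> lie_K u" and t: "z' = phase_act t z" "w' = phase_act t (w + inf_act Y z)"
    unfolding d_proj_eq_iff by (elim bexE conjE) (rule that)
  have "w' = phase_act s (w + inf_act Y z)"
    unfolding t(2) by (rule phase_act_eq_cong[OF nz]) (metis s(1) t(1))
  then have "r = flat_form (v + inf_act X z) (w + inf_act Y z)"
    by (simp only: r s(2) flat_form_phase_act)
  also have "\<dots> = flat_form v (w + inf_act Y z)"
    using flat_form_inf_act[OF subspace_add[OF subspace_level_tangent w inf_act_level_tangent] X, of Y]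
    by (simp add: flat_form_add_left)
  also have "\<dots> = - flat_form (w + inf_act Y z) v"
    by (rule flat_form_swap)
  also have "\<dots> = flat_form v w"
    by (simp add: flat_form_add_left flat_form_inf_act[OF v Y] flat_form_swap[of v w])
  finally show "r = flat_form v w" .
qed

lemma A_map_right_inverse:
  obtains R :: "(real ^ 'd) \<Rightarrow>\<^sub>L (real ^ 'n)" where "\<And>x. (\<Sum>j\<in>UNIV. (blinfun_apply R x $ j) *\<^sub>R u j) = x"
proof -
  have lin: "linear (blinfun_apply (A_map u))"
    by (simp add: blinfun.bounded_linear_right bounded_linear.linear)
  have "u j \<in> range (blinfun_apply (A_map u))" for j
    by (rule range_eqI[of _ _ "axis j 1"]) (simp add: A_map_apply axis_def if_distrib[of "\<lambda>c. c *\<^sub>R _"] cong: if_cong)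
  then have "span (range u) \<subseteq> range (blinfun_apply (A_map u))"
    by (intro span_minimal linear_subspace_image[OF lin]) auto
  then have "surj (blinfun_apply (A_map u))"
    by (auto simp: span_u)
  then obtain g where g: "linear g" "blinfun_apply (A_map u) \<circ> g = id"
    using linear_surjective_right_inverse[OF lin] by blast
  then have "blinfun_apply (Blinfun g) = g"
    by (simp add: bounded_linear_Blinfun_apply linear_conv_bounded_linear)
  moreover have "blinfun_apply (A_map u) (g x) = x" for x
    using g(2) by (metis comp_apply id_apply)
  ultimately show thesis
    using that[of "Blinfun g"] by (simp add: A_map_apply)
qed

text \<open>
  On the level set the functional \<open>moment z + lam_covec lam\<close> vanishes on the kernel of \<open>A\<close>, so it
  factors through \<open>A\<close>; composing it with a right inverse of \<open>A\<close> gives the factor, which is the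
  preimage of \<open>moment z\<close> under \<open>iota\<close>.
\<close>

lemma moment_P_orbit_proj:
  assumes z: "z \<in> level_set u lam"
  shows "blinfun_apply (moment_P u lam (orbit_proj L u z)) (u j) = (cmod (z $ j))\<^sup>2 + lam j"
proof -
  have "(SOME z'. z' \<in> orbit_proj L u z) \<in> orbit_proj L u z"
    using self_orbit by (rule someI)
  then obtain t where "(SOME z'. z' \<in> orbit_proj L u z) = phase_act t z"
    by (auto simp: orbit_proj_eq)
  then have mom: "moment_P u lam (orbit_proj L u z) = inv (iota u lam) (moment z)"
    by (simp add: moment_P_def moment_def cmod_phase_act)
  obtain R where R: "\<And>x. (\<Sum>j\<in>UNIV. (blinfun_apply R x $ j) *\<^sub>R u j) = x"
    using A_map_right_inverse by blast
  define \<eta> where "\<eta> = (moment z + lam_covec lam) o\<^sub>L R"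
  have ker: "blinfun_apply (moment z + lam_covec lam) X = 0" if "X \<in> lie_K u" for X
    using z that by (simp add: mem_level_set blinfun.add_left moment_apply lam_covec_apply distrib_right sum.distrib)
  have \<eta>: "blinfun_apply \<eta> (\<Sum>j\<in>UNIV. (t $ j) *\<^sub>R u j) = blinfun_apply (moment z + lam_covec lam) t" for t
  proof -
    have "blinfun_apply R (\<Sum>j\<in>UNIV. (t $ j) *\<^sub>R u j) - t \<in> lie_K u"
      using R[of "\<Sum>j\<in>UNIV. (t $ j) *\<^sub>R u j"]
      by (simp add: mem_lie_K scaleR_diff_left sum_subtractf)
    from ker[OF this] show ?thesis
      by (simp add: \<eta>_def blinfun.diff_right)
  qed
  have "iota u lam \<eta> = moment z"
  proof (rule blinfun_eqI)
    fix t
    have "blinfun_apply (iota u lam \<eta>) t = - blinfun_apply (lam_covec lam) t + blinfun_apply \<eta> (\<Sum>j\<in>UNIV. (t $ j) *\<^sub>R u j)"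
      by (simp add: iota_def blinfun.add_left blinfun.diff_left blinfun.minus_left A_map_apply)
    then show "blinfun_apply (iota u lam \<eta>) t = blinfun_apply (moment z) t"
      by (simp add: \<eta> blinfun.add_left)
  qed
  then have "moment z \<in> range (iota u lam)"
    by (metis rangeI)
  then have "iota u lam (moment_P u lam (orbit_proj L u z)) = moment z"
    unfolding mom by (rule f_inv_into_f)
  then have "blinfun_apply (iota u lam (moment_P u lam (orbit_proj L u z))) (axis j 1) = blinfun_apply (moment z) (axis j 1)"
    by simp
  then show ?thesis
    by (simp add: iota_apply moment_apply axis_def if_distrib cong: if_cong)
qed

text \<open>
  Where one of the inequalities is an equality, it is violated after an arbitrarily small step
  against \<open>u\<^sub>j\<close>, because \<open>u\<^sub>j\<close> is not zero.
\<close>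

lemma interior_polyhedron:
  "interior (polyhedron_of u lam) = {\<eta>. \<forall>j. lam j < blinfun_apply \<eta> (u j)}"
proof (rule antisym; rule subsetI)
  fix \<eta> assume "\<eta> \<in> interior (polyhedron_of u lam)"
  then obtain e where e: "0 < e" "ball \<eta> e \<subseteq> polyhedron_of u lam"
    by (meson interior_subset open_contains_ball open_interior subset_trans)
  have "lam j < blinfun_apply \<eta> (u j)" for j
  proof -
    define c where "c = e / 2 / (norm (blinfun_inner_left (u j)) + 1)"
    have c: "0 < c" "c * norm (blinfun_inner_left (u j)) < e"
      using e(1) by (auto simp: c_def field_simps add_nonneg_pos add_pos_nonneg)
    then have "\<eta> - c *\<^sub>R blinfun_inner_left (u j) \<in> ball \<eta> e"
      by (simp add: dist_norm)
    then have "\<eta> - c *\<^sub>R blinfun_inner_left (u j) \<in> polyhedron_of u lam"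
      using e(2) by blast
    then have "lam j \<le> blinfun_apply (\<eta> - c *\<^sub>R blinfun_inner_left (u j)) (u j)"
      by (simp add: polyhedron_of_def)
    then have "lam j \<le> blinfun_apply \<eta> (u j) - c * (u j \<bullet> u j)"
      by (simp add: blinfun.diff_left blinfun.scaleR_left)
    moreover have "0 < c * (u j \<bullet> u j)"
      using c(1) u_nonzero[of j] by simp
    ultimately show ?thesis by linarith
  qed
  then show "\<eta> \<in> {\<eta>. \<forall>j. lam j < blinfun_apply \<eta> (u j)}" by simp
next
  have "{\<eta>. \<forall>j. lam j < blinfun_apply \<eta> (u j)} = (\<Inter>j. {\<eta>. lam j < blinfun_apply \<eta> (u j)})"
    by auto
  also have "open \<dots>"
    by (intro open_INT ballI open_Collect_less continuous_intros) auto
  finally have op: "open {\<eta>. \<forall>j. lam j < blinfun_apply \<eta> (u j)}" .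
  fix \<eta> assume "\<eta> \<in> {\<eta>. \<forall>j. lam j < blinfun_apply \<eta> (u j)}"
  then show "\<eta> \<in> interior (polyhedron_of u lam)"
    by (intro interiorI[OF op]) (auto simp: polyhedron_of_def less_imp_le)
qed

lemma mem_M_open:
  "p \<in> M_open L u lam \<longleftrightarrow> (\<exists>z\<in>level_set u lam. p = orbit_proj L u z \<and> (\<forall>j. z $ j \<noteq> 0))"
  by (auto simp: M_open_def M_quot_def interior_polyhedron moment_P_orbit_proj)

lemma orbit_proj_M_open:
  assumes "z \<in> level_set u lam"
  shows "orbit_proj L u z \<in> M_open L u lam \<longleftrightarrow> (\<forall>j. z $ j \<noteq> 0)"
  using assms by (auto simp: M_open_def M_quot_def interior_polyhedron moment_P_orbit_proj)

end

section \<open>The potential along a holomorphic lift\<close>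

lemma has_derivative_norm_square_add_const:
  assumes "(s has_derivative s') (at w)"
  shows "((\<lambda>w. (cmod (s w $ j))\<^sup>2 + a) has_derivative (\<lambda>x. 2 * (s w $ j \<bullet> s' x $ j))) (at w)"
proof -
  have d: "((\<lambda>w. s w $ j) has_derivative (\<lambda>x. s' x $ j)) (at w)"
    by (rule bounded_linear.has_derivative[OF bounded_linear_vec_nth assms])
  have "((\<lambda>w. s w $ j \<bullet> s w $ j + a) has_derivative (\<lambda>x. s w $ j \<bullet> s' x $ j + s' x $ j \<bullet> s w $ j + 0)) (at w)"
    by (intro has_derivative_add has_derivative_inner d has_derivative_const)
  then show ?thesis
    unfolding power2_norm_eq_inner by (simp add: inner_commute)
qed

lemma derivative_level_tangent:
  assumes U: "open U" "w \<in> U" and d: "(s has_derivative s') (at w)"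
    and level: "\<And>w. w \<in> U \<Longrightarrow> s w \<in> level_set u lam"
  shows "s' x \<in> level_tangent u (s w)"
  unfolding mem_level_tangent
proof
  fix X assume X: "X \<in> lie_K u"
  define g where "g w = (\<Sum>j\<in>UNIV. ((cmod (s w $ j))\<^sup>2 + lam j) * X $ j)" for w
  have "(g has_derivative (\<lambda>x. \<Sum>j\<in>UNIV. (2 * (s w $ j \<bullet> s' x $ j)) * X $ j)) (at w)"
    unfolding g_def by (intro has_derivative_sum has_derivative_mult_left has_derivative_norm_square_add_const[OF d])
  moreover have "(g has_derivative (\<lambda>_. 0)) (at w)"
    by (rule has_derivative_transform_within_open[OF has_derivative_const[of 0] U])
       (use level X in \<open>auto simp: g_def mem_level_set\<close>)
  ultimately have "(\<lambda>x. \<Sum>j\<in>UNIV. (2 * (s w $ j \<bullet> s' x $ j)) * X $ j) = (\<lambda>_. 0)"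
    by (rule has_derivative_unique)
  then have "(\<Sum>j\<in>UNIV. (2 * (s w $ j \<bullet> s' x $ j)) * X $ j) = 0"
    by (rule fun_cong)
  then have "2 * (\<Sum>j\<in>UNIV. (s w $ j \<bullet> s' x $ j) * X $ j) = 0"
    by (simp only: sum_distrib_left mult.assoc)
  then show "(\<Sum>j\<in>UNIV. (s w $ j \<bullet> s' x $ j) * X $ j) = 0"
    by simp
qed

context toric_data begin

text \<open>
  A functional on \<open>real ^ 'n\<close> that vanishes on the kernel of \<open>A\<close> is a functional of \<open>A t\<close>, with
  components given by its values on a right inverse of \<open>A\<close>.
\<close>

lemma lie_K_annihilator_descends:
  fixes R :: "(real ^ 'd) \<Rightarrow>\<^sub>L (real ^ 'n)"
  assumes R: "\<And>x. (\<Sum>j\<in>UNIV. (blinfun_apply R x $ j) *\<^sub>R u j) = x"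
    and c: "\<And>X. X \<in> lie_K u \<Longrightarrow> (\<Sum>j\<in>UNIV. c j * X $ j) = 0"
  shows "(\<Sum>j\<in>UNIV. c j * t j)
    = (\<Sum>m\<in>UNIV. (\<Sum>j\<in>UNIV. c j * blinfun_apply R (axis m 1) $ j) * (\<Sum>j\<in>UNIV. t j *\<^sub>R u j) $ m)"
proof -
  define At where "At = (\<Sum>j\<in>UNIV. t j *\<^sub>R u j)"
  have "(\<chi> j. t j) - blinfun_apply R At \<in> lie_K u"
    by (simp add: mem_lie_K scaleR_diff_left sum_subtractf R At_def)
  from c[OF this] have "(\<Sum>j\<in>UNIV. c j * t j) = (\<Sum>j\<in>UNIV. c j * blinfun_apply R At $ j)"
    by (simp add: right_diff_distrib sum_subtractf)
  also have "blinfun_apply R At = (\<Sum>m\<in>UNIV. At $ m *\<^sub>R blinfun_apply R (axis m 1))"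
  proof -
    have e: "At = (\<Sum>m\<in>UNIV. At $ m *\<^sub>R axis m 1)"
      by (simp add: vec_eq_iff axis_def if_distrib cong: if_cong)
    show ?thesis
      by (subst (1) e) (simp only: blinfun.scaleR_right blinfun.sum_right)
  qed
  also have "(\<Sum>j\<in>UNIV. c j * (\<Sum>m\<in>UNIV. At $ m *\<^sub>R blinfun_apply R (axis m 1)) $ j)
      = (\<Sum>m\<in>UNIV. (\<Sum>j\<in>UNIV. c j * blinfun_apply R (axis m 1) $ j) * At $ m)"
    by (simp add: sum_distrib_left sum_distrib_right mult_ac) (rule sum.swap)
  finally show ?thesis by (simp only: At_def)
qed

end

text \<open>
  A \<open>C\<^sup>1\<close> map to the level set, avoiding the coordinate hyperplanes, whose composition with the
  quotient map is holomorphic in the sense that \<open>log_diff\<close> is complex linear along it.  The right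
  inverse \<open>R\<close> of \<open>A\<close> serves to write functionals that vanish on the kernel of \<open>A\<close> in coordinates.
\<close>

locale holomorphic_lift = toric_data L u
  for L :: "(real ^ 'd::finite) set" and u :: "'n::finite \<Rightarrow> real ^ 'd" +
  fixes lam :: "'n \<Rightarrow> real" and U :: "(complex ^ 'd) set"
    and s :: "complex ^ 'd \<Rightarrow> complex ^ 'n" and s' :: "complex ^ 'd \<Rightarrow> complex ^ 'd \<Rightarrow> complex ^ 'n"
    and R :: "(real ^ 'd) \<Rightarrow>\<^sub>L (real ^ 'n)"
  assumes open_U: "open U"
    and deriv_s: "\<And>w. w \<in> U \<Longrightarrow> (s has_derivative s' w) (at w)"
    and cont_s': "\<And>x. continuous_on U (\<lambda>w. s' w x)"
    and level: "\<And>w. w \<in> U \<Longrightarrow> s w \<in> level_set u lam"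
    and nonzero: "\<And>w j. w \<in> U \<Longrightarrow> s w $ j \<noteq> 0"
    and log_diff_i: "\<And>w x. w \<in> U \<Longrightarrow> log_diff u (s w) (s' w (\<i> *s x)) = \<i> *s log_diff u (s w) (s' w x)"
    and R: "\<And>x. (\<Sum>j\<in>UNIV. (blinfun_apply R x $ j) *\<^sub>R u j) = x"
begin

text \<open>
  The logarithmic derivative of the coordinate \<open>j\<close> of the lift.
\<close>

definition \<sigma> :: "complex ^ 'd \<Rightarrow> complex ^ 'd \<Rightarrow> 'n \<Rightarrow> complex" where
  "\<sigma> w x j = s' w x $ j / s w $ j"

text \<open>
  The component \<open>m\<close> of the differential of the holomorphic coordinate \<open>\<Sum>j. log (s\<^sub>j) u\<^sub>j\<close>.
\<close>

definition \<Lambda> :: "complex ^ 'd \<Rightarrow> 'd \<Rightarrow> complex ^ 'd \<Rightarrow> complex" where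
  "\<Lambda> w m x = log_diff u (s w) (s' w x) $ m"

text \<open>
  The component \<open>m\<close> of the value of the moment map \<open>moment_P\<close> along the lift.
\<close>

definition \<eta> :: "'d \<Rightarrow> complex ^ 'd \<Rightarrow> real" where
  "\<eta> m w = (\<Sum>j\<in>UNIV. ((cmod (s w $ j))\<^sup>2 + lam j) * blinfun_apply R (axis m 1) $ j)"

text \<open>
  The differential of \<open>\<eta> m\<close> at \<open>w\<close>.
\<close>

definition \<epsilon> :: "complex ^ 'd \<Rightarrow> 'd \<Rightarrow> complex ^ 'd \<Rightarrow> real" where
  "\<epsilon> w m x = (\<Sum>j\<in>UNIV. (2 * (s w $ j \<bullet> s' w x $ j)) * blinfun_apply R (axis m 1) $ j)"

text \<open>
  The pairing of \<open>d\<eta>\<close> in the direction \<open>x\<close> with \<open>Re \<Lambda>\<close> in the direction \<open>y\<close>, see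
  \<open>\<epsilon>_Re_\<Lambda>\<close>; in this form its symmetry is evident.
\<close>

definition S :: "complex ^ 'd \<Rightarrow> complex ^ 'd \<Rightarrow> complex ^ 'd \<Rightarrow> real" where
  "S w x y = (\<Sum>j\<in>UNIV. 2 * (cmod (s w $ j))\<^sup>2 * Re (\<sigma> w x j) * Re (\<sigma> w y j))"

lemma linear_s': "w \<in> U \<Longrightarrow> linear (s' w)"
  by (rule has_derivative_linear[OF deriv_s])

lemma deriv_nth: "w \<in> U \<Longrightarrow> ((\<lambda>w. s w $ j) has_derivative (\<lambda>x. s' w x $ j)) (at w)"
  by (rule bounded_linear.has_derivative[OF bounded_linear_vec_nth deriv_s])

lemma deriv_norm_add_const:
  "w \<in> U \<Longrightarrow> ((\<lambda>w. (cmod (s w $ j))\<^sup>2 + a) has_derivative (\<lambda>x. 2 * (s w $ j \<bullet> s' w x $ j))) (at w)"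
  by (rule has_derivative_norm_square_add_const[OF deriv_s])

lemma deriv_norm:
  "w \<in> U \<Longrightarrow> ((\<lambda>w. (cmod (s w $ j))\<^sup>2) has_derivative (\<lambda>x. 2 * (s w $ j \<bullet> s' w x $ j))) (at w)"
  using deriv_norm_add_const[where a = 0] by simp

lemma s'_level_tangent: "w \<in> U \<Longrightarrow> s' w x \<in> level_tangent u (s w)"
  by (rule derivative_level_tangent[OF open_U _ _ level]) (auto intro: deriv_s)

lemma inner_\<sigma>: "w \<in> U \<Longrightarrow> s w $ j \<bullet> s' w x $ j = (cmod (s w $ j))\<^sup>2 * Re (\<sigma> w x j)"
  unfolding \<sigma>_def by (rule inner_eq_norm_Re_divide[OF nonzero])

lemma Re_\<Lambda>: "Re (\<Lambda> w m x) = (\<Sum>j\<in>UNIV. Re (\<sigma> w x j) *\<^sub>R u j) $ m"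
  unfolding \<Lambda>_def \<sigma>_def by (rule Re_log_diff)

lemma Im_\<Lambda>: "Im (\<Lambda> w m x) = (\<Sum>j\<in>UNIV. Im (\<sigma> w x j) *\<^sub>R u j) $ m"
  unfolding \<Lambda>_def \<sigma>_def by (rule Im_log_diff)

lemma \<Lambda>_i: "w \<in> U \<Longrightarrow> \<Lambda> w m (\<i> *s x) = \<i> * \<Lambda> w m x"
  by (simp add: \<Lambda>_def log_diff_i)

lemma linear_\<Lambda>: "w \<in> U \<Longrightarrow> linear (\<Lambda> w m)"
  using linear_s'[of w]
  by (intro linearI)
     (simp_all add: \<Lambda>_def log_diff_add linear_add linear_scale log_diff_nth
       scaleR_conv_of_real[where 'a=complex] sum_distrib_left mult.assoc)

lemma \<eta>_Re_\<Lambda>: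
  assumes w: "w \<in> U"
  shows "(\<Sum>j\<in>UNIV. ((cmod (s w $ j))\<^sup>2 + lam j) * Re (\<sigma> w x j)) = (\<Sum>m\<in>UNIV. \<eta> m w * Re (\<Lambda> w m x))"
  unfolding \<eta>_def Re_\<Lambda>
  by (rule lie_K_annihilator_descends[OF R]) (use level[OF w] in \<open>simp add: mem_level_set\<close>)

lemma \<epsilon>_pairing:
  assumes w: "w \<in> U"
  shows "(\<Sum>m\<in>UNIV. \<epsilon> w m x * (\<Sum>j\<in>UNIV. t j *\<^sub>R u j) $ m)
    = (\<Sum>j\<in>UNIV. 2 * (cmod (s w $ j))\<^sup>2 * Re (\<sigma> w x j) * t j)"
proof -
  have "(\<Sum>m\<in>UNIV. \<epsilon> w m x * (\<Sum>j\<in>UNIV. t j *\<^sub>R u j) $ m) = (\<Sum>j\<in>UNIV. (2 * (s w $ j \<bullet> s' w x $ j)) * t j)"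
    unfolding \<epsilon>_def
  proof (rule lie_K_annihilator_descends[OF R, symmetric])
    fix X assume "X \<in> lie_K u"
    then have "2 * (\<Sum>j\<in>UNIV. (s w $ j \<bullet> s' w x $ j) * X $ j) = 0"
      using s'_level_tangent[OF w] by (simp add: mem_level_tangent)
    then show "(\<Sum>j\<in>UNIV. (2 * (s w $ j \<bullet> s' w x $ j)) * X $ j) = 0"
      by (simp only: sum_distrib_left mult.assoc)
  qed
  then show ?thesis
    by (simp add: inner_\<sigma>[OF w] mult.assoc)
qed

lemma \<epsilon>_Re_\<Lambda>: "w \<in> U \<Longrightarrow> (\<Sum>m\<in>UNIV. \<epsilon> w m x * Re (\<Lambda> w m y)) = S w x y"
  unfolding Re_\<Lambda> S_def by (rule \<epsilon>_pairing)

lemma \<epsilon>_Im_\<Lambda>: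
  "w \<in> U \<Longrightarrow> (\<Sum>m\<in>UNIV. \<epsilon> w m x * Im (\<Lambda> w m y))
    = (\<Sum>j\<in>UNIV. 2 * (cmod (s w $ j))\<^sup>2 * Re (\<sigma> w x j) * Im (\<sigma> w y j))"
  unfolding Im_\<Lambda> by (rule \<epsilon>_pairing)

lemma \<epsilon>_Im_\<Lambda>_eq_S:
  assumes w: "w \<in> U"
  shows "(\<Sum>m\<in>UNIV. \<epsilon> w m x * Im (\<Lambda> w m y)) = - S w x (\<i> *s y)"
proof -
  have "Im (\<Lambda> w m y) = - Re (\<Lambda> w m (\<i> *s y))" for m
    by (simp add: \<Lambda>_i[OF w])
  then have "(\<Sum>m\<in>UNIV. \<epsilon> w m x * Im (\<Lambda> w m y)) = - (\<Sum>m\<in>UNIV. \<epsilon> w m x * Re (\<Lambda> w m (\<i> *s y)))"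
    by (simp add: sum_negf)
  then show ?thesis
    by (simp only: \<epsilon>_Re_\<Lambda>[OF w])
qed

lemma S_sym: "S w x y = S w y x"
  by (simp add: S_def mult_ac)

text \<open>
  Written with \<open>\<sigma>\<close>, the flat form is \<open>-2 \<Sum>j. \<bar>s\<^sub>j\<bar>\<^sup>2 Im (\<sigma>\<^sub>j(x) cnj (\<sigma>\<^sub>j(y)))\<close>.  Each of the two
  products of a real and an imaginary part is the pairing of \<open>d\<eta>\<close> with \<open>Im \<Lambda>\<close>, which complex
  linearity of \<open>\<Lambda>\<close> turns into \<open>- Re \<Lambda>\<close> at \<open>\<i>\<close> times the vector.
\<close>

lemma flat_form_S:
  assumes w: "w \<in> U"
  shows "flat_form (s' w x) (s' w y) = of_real (S w y (\<i> *s x) - S w x (\<i> *s y))"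
proof -
  have T: "(\<Sum>j\<in>UNIV. 2 * (cmod (s w $ j))\<^sup>2 * Re (\<sigma> w x j) * Im (\<sigma> w y j)) = - S w x (\<i> *s y)" for x y
    using \<epsilon>_Im_\<Lambda>[OF w, of x y] \<epsilon>_Im_\<Lambda>_eq_S[OF w, of x y] by simp
  have "s' w x $ j * cnj (s' w y $ j) - s' w y $ j * cnj (s' w x $ j)
      = \<i> * of_real (2 * (cmod (s w $ j))\<^sup>2 * Re (\<sigma> w y j) * Im (\<sigma> w x j)
                   - 2 * (cmod (s w $ j))\<^sup>2 * Re (\<sigma> w x j) * Im (\<sigma> w y j))" for j
  proof -
    have v: "s' w x $ j = s w $ j * \<sigma> w x j" for x
      using nonzero[OF w] by (simp add: \<sigma>_def)
    have "s' w x $ j * cnj (s' w y $ j) - s' w y $ j * cnj (s' w x $ j)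
        = (s w $ j * cnj (s w $ j)) * (\<sigma> w x j * cnj (\<sigma> w y j) - \<sigma> w y j * cnj (\<sigma> w x j))"
      unfolding v complex_cnj_mult by (simp only: algebra_simps)
    also have "\<sigma> w x j * cnj (\<sigma> w y j) - \<sigma> w y j * cnj (\<sigma> w x j)
        = \<i> * of_real (2 * Re (\<sigma> w y j) * Im (\<sigma> w x j) - 2 * Re (\<sigma> w x j) * Im (\<sigma> w y j))"
      by (simp add: complex_eq_iff)
    also have "s w $ j * cnj (s w $ j) = of_real ((cmod (s w $ j))\<^sup>2)"
      by (simp only: complex_norm_square)
    finally show ?thesis
      by (simp add: algebra_simps)
  qed
  then have "flat_form (s' w x) (s' w y) = \<i> * (\<i> * of_real (- S w y (\<i> *s x) - - S w x (\<i> *s y)))"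
    unfolding flat_form_def T[symmetric] by (simp only: sum_subtractf sum_distrib_left of_real_sum of_real_diff right_diff_distrib)
  then show ?thesis
    by (simp add: algebra_simps flip: mult.assoc)
qed

text \<open>
  Near \<open>w0\<close>, \<open>\<Lambda>\<close> is the differential of a \<open>C\<^sup>1\<close> function \<open>h\<close>, a branch of \<open>\<Sum>j. log (s\<^sub>j) u\<^sub>j\<close> up to a
  constant.  Dividing \<open>s\<^sub>j\<close> by its value at \<open>w0\<close> keeps the arguments in the domain of the principal
  branch.
\<close>

lemma \<Lambda>_differentiable:
  assumes w0: "w0 \<in> U"
  obtains D where "((\<lambda>w. \<Lambda> w m e) has_derivative D) (at w0)" "\<And>x. D (\<i> *s x) = \<i> * D x"
proof -
  define V where "V = {w \<in> U. \<forall>j. 0 < Re (s w $ j / s w0 $ j)}"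
  have cont_s: "continuous_on U s"
    by (intro continuous_at_imp_continuous_on ballI has_derivative_continuous[OF deriv_s])
  have cont_nth: "continuous_on U (\<lambda>w. s w $ j)" for j
    using continuous_on_component[OF cont_s] .
  have op: "open (U \<inter> (\<lambda>w. Re (s w $ j / s w0 $ j)) -` {0<..})" for j
  proof (rule continuous_open_preimage[OF _ open_U open_greaterThan])
    show "continuous_on U (\<lambda>w. Re (s w $ j / s w0 $ j))"
      by (intro continuous_on_Re continuous_on_divide cont_nth continuous_on_const ballI nonzero[OF w0])
  qed
  have "open (U \<inter> (\<Inter>j. U \<inter> (\<lambda>w. Re (s w $ j / s w0 $ j)) -` {0<..}))"
    by (intro open_Int[OF open_U open_INT] finite ballI) (rule op)
  moreover have "U \<inter> (\<Inter>j. U \<inter> (\<lambda>w. Re (s w $ j / s w0 $ j)) -` {0<..}) = V"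
    unfolding V_def by auto
  ultimately have V: "open V"
    by simp
  have w0V: "w0 \<in> V"
    unfolding V_def by (simp add: w0 nonzero[OF w0])
  define h where "h w = (\<Sum>j\<in>UNIV. Ln (s w $ j / s w0 $ j) * of_real (u j $ m))" for w
  have Ln: "((\<lambda>w. Ln (s w $ j / s w0 $ j)) has_derivative (\<lambda>x. s' w x $ j / s w $ j)) (at w)" if w: "w \<in> V" for w j
  proof -
    have wU: "w \<in> U" and pos: "0 < Re (s w $ j / s w0 $ j)" using w by (auto simp: V_def)
    have a: "((\<lambda>w. s w $ j / s w0 $ j) has_derivative (\<lambda>x. s' w x $ j / s w0 $ j)) (at w)"
      by (rule bounded_linear.has_derivative[OF bounded_linear_divide deriv_nth[OF wU]])
    have "(Ln has_field_derivative inverse (s w $ j / s w0 $ j)) (at (s w $ j / s w0 $ j))"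
      using pos by (intro has_field_derivative_Ln) (auto simp: complex_nonpos_Reals_iff)
    then have b: "(Ln has_derivative (*) (inverse (s w $ j / s w0 $ j))) (at (s w $ j / s w0 $ j))"
      by (simp only: has_field_derivative_def)
    have "(\<lambda>x. inverse (s w $ j / s w0 $ j) * (s' w x $ j / s w0 $ j)) = (\<lambda>x. s' w x $ j / s w $ j)"
      using nonzero[OF wU, of j] nonzero[OF w0, of j] by (simp add: fun_eq_iff)
    with has_derivative_compose[OF a b] show ?thesis
      by (simp only:)
  qed
  have h: "(h has_derivative \<Lambda> w m) (at w)" if w: "w \<in> V" for w
    unfolding h_def[abs_def] \<Lambda>_def[abs_def] log_diff_nth
    by (intro has_derivative_sum has_derivative_mult_left Ln w)
  have VU: "V \<subseteq> U"
    by (auto simp: V_def)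
  have cont: "continuous_on V (\<lambda>w. \<Lambda> w m x)" for x
    unfolding \<Lambda>_def log_diff_nth
    by (rule continuous_on_subset[OF _ VU])
       (intro continuous_on_sum continuous_on_mult continuous_on_divide continuous_on_const
          continuous_on_component cont_s' cont_nth ballI nonzero)
  have J: "\<Lambda> w m (\<i> *s x) = \<i> * \<Lambda> w m x" if "w \<in> V" for w x
    using that VU by (intro \<Lambda>_i) auto
  show thesis
    by (rule partial_derivative_complex_differentiable[OF V w0V h J cont, where e = e]) (assumption+, rule that, assumption, simp)
qed

text \<open>
  The potential \<open>\<Sum>j. lam j * ln (\<langle>\<eta>, u j\<rangle> - lam j) + \<langle>\<eta>, u j\<rangle>\<close> at a point of the level set, where
  \<open>\<langle>\<eta>, u j\<rangle> - lam j\<close> is the squared modulus of the coordinate \<open>j\<close>.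
\<close>

definition potential :: "complex ^ 'd \<Rightarrow> complex" where
  "potential w = complex_of_real (\<Sum>j\<in>UNIV. lam j * ln ((cmod (s w $ j))\<^sup>2) + ((cmod (s w $ j))\<^sup>2 + lam j))"

text \<open>
  Legendre duality: the coefficient of \<open>Re \<sigma>\<^sub>j\<close> in the differential is
  \<open>2 \<bar>s\<^sub>j\<bar>\<^sup>2 (lam j / \<bar>s\<^sub>j\<bar>\<^sup>2 + 1) = 2 (\<bar>s\<^sub>j\<bar>\<^sup>2 + lam j)\<close>, and as a functional of \<open>Re \<sigma>\<close> this is
  twice the value of the moment map.
\<close>

lemma deriv_potential:
  assumes w: "w \<in> U"
  shows "(potential has_derivative (\<lambda>x. of_real (2 * (\<Sum>m\<in>UNIV. \<eta> m w * Re (\<Lambda> w m x))))) (at w)"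
proof -
  have pos: "0 < (cmod (s w $ j))\<^sup>2" for j
    using nonzero[OF w] by simp
  have "((\<lambda>w. \<Sum>j\<in>UNIV. lam j * ln ((cmod (s w $ j))\<^sup>2) + ((cmod (s w $ j))\<^sup>2 + lam j))
      has_derivative (\<lambda>x. \<Sum>j\<in>UNIV. lam j * (2 * (s w $ j \<bullet> s' w x $ j) / (cmod (s w $ j))\<^sup>2) + 2 * (s w $ j \<bullet> s' w x $ j))) (at w)"
  proof (intro has_derivative_sum has_derivative_add[OF _ deriv_norm_add_const[OF w]] has_derivative_mult_right)
    fix j
    have "(ln has_derivative (*) (inverse ((cmod (s w $ j))\<^sup>2))) (at ((cmod (s w $ j))\<^sup>2))"
      using DERIV_ln[OF pos] by (simp only: has_field_derivative_def)
    from has_derivative_compose[OF deriv_norm[OF w] this]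
    show "((\<lambda>w. ln ((cmod (s w $ j))\<^sup>2)) has_derivative (\<lambda>x. 2 * (s w $ j \<bullet> s' w x $ j) / (cmod (s w $ j))\<^sup>2)) (at w)"
      by (simp add: divide_inverse mult.commute)
  qed
  moreover have "(\<Sum>j\<in>UNIV. lam j * (2 * (s w $ j \<bullet> s' w x $ j) / (cmod (s w $ j))\<^sup>2) + 2 * (s w $ j \<bullet> s' w x $ j))
      = 2 * (\<Sum>m\<in>UNIV. \<eta> m w * Re (\<Lambda> w m x))" for x
    unfolding \<eta>_Re_\<Lambda>[OF w, symmetric] sum_distrib_left inner_\<sigma>[OF w]
    using nonzero[OF w] by (intro sum.cong refl) (simp add: algebra_simps)
  ultimately have "((\<lambda>w. \<Sum>j\<in>UNIV. lam j * ln ((cmod (s w $ j))\<^sup>2) + ((cmod (s w $ j))\<^sup>2 + lam j))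
      has_derivative (\<lambda>x. 2 * (\<Sum>m\<in>UNIV. \<eta> m w * Re (\<Lambda> w m x)))) (at w)"
    by simp
  from has_derivative_of_real[OF this] show ?thesis
    by (simp add: potential_def[abs_def])
qed

lemma wirt_bar_potential:
  assumes w: "w \<in> U"
  shows "wirt_bar l potential w = (\<Sum>m\<in>UNIV. of_real (\<eta> m w) * cnj (\<Lambda> w m (axis l 1)))"
proof -
  have ax: "axis l \<i> = \<i> *s axis l 1"
    by (simp add: vec_eq_iff axis_def)
  have "wirt_bar l potential w = (of_real (2 * (\<Sum>m\<in>UNIV. \<eta> m w * Re (\<Lambda> w m (axis l 1))))
     + \<i> * of_real (2 * (\<Sum>m\<in>UNIV. \<eta> m w * Re (\<Lambda> w m (axis l \<i>))))) / 2"
    by (simp only: wirt_bar_def frechet_derivative_at[OF deriv_potential[OF w], symmetric])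
  also have "\<dots> = (\<Sum>m\<in>UNIV. of_real (\<eta> m w * Re (\<Lambda> w m (axis l 1)))) - \<i> * (\<Sum>m\<in>UNIV. of_real (\<eta> m w * Im (\<Lambda> w m (axis l 1))))"
    by (simp add: ax \<Lambda>_i[OF w] sum_negf)
  also have "\<dots> = (\<Sum>m\<in>UNIV. of_real (\<eta> m w) * cnj (\<Lambda> w m (axis l 1)))"
    unfolding sum_distrib_left sum_subtractf[symmetric]
    by (intro sum.cong refl) (simp add: complex_eq_iff)
  finally show ?thesis .
qed

lemma deriv_\<eta>: "w \<in> U \<Longrightarrow> (\<eta> m has_derivative \<epsilon> w m) (at w)"
  unfolding \<eta>_def[abs_def] \<epsilon>_def[abs_def] by (intro has_derivative_sum has_derivative_mult_left deriv_norm_add_const)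

text \<open>
  The factor \<open>cnj \<Lambda>\<close> in the antiholomorphic derivatives is antiholomorphic in \<open>w\<close>, so only the
  differential of \<open>\<eta>\<close> contributes.
\<close>

lemma wirt_wirt_bar_potential:
  assumes w: "w \<in> U"
  shows "wirt k (wirt_bar l potential) w
    = (\<Sum>m\<in>UNIV. (of_real (\<epsilon> w m (axis k 1)) - \<i> * of_real (\<epsilon> w m (axis k \<i>))) / 2 * cnj (\<Lambda> w m (axis l 1)))"
proof -
  have "\<exists>D. ((\<lambda>w. \<Lambda> w m (axis l 1)) has_derivative D) (at w) \<and> (\<forall>x. D (\<i> *s x) = \<i> * D x)" for m
    using \<Lambda>_differentiable[OF w] by metis
  then obtain D where D: "\<And>m. ((\<lambda>w. \<Lambda> w m (axis l 1)) has_derivative D m) (at w)"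
    and Di: "\<And>m x. D m (\<i> *s x) = \<i> * D m x"
    by metis
  have "((\<lambda>w. \<Sum>m\<in>UNIV. of_real (\<eta> m w) * cnj (\<Lambda> w m (axis l 1))) has_derivative
      (\<lambda>x. \<Sum>m\<in>UNIV. of_real (\<eta> m w) * cnj (D m x) + of_real (\<epsilon> w m x) * cnj (\<Lambda> w m (axis l 1)))) (at w)"
    by (intro has_derivative_sum has_derivative_mult has_derivative_of_real has_derivative_cnj deriv_\<eta>[OF w] D)
  then have "(wirt_bar l potential has_derivative
      (\<lambda>x. \<Sum>m\<in>UNIV. of_real (\<eta> m w) * cnj (D m x) + of_real (\<epsilon> w m x) * cnj (\<Lambda> w m (axis l 1)))) (at w)"
    by (rule has_derivative_transform_within_open[OF _ open_U w]) (simp add: wirt_bar_potential)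
  note fd = frechet_derivative_at[OF this, symmetric]
  have ax: "axis k \<i> = \<i> *s axis k 1"
    by (simp add: vec_eq_iff axis_def)
  have Dax: "D m (axis k \<i>) = \<i> * D m (axis k 1)" for m
    by (simp only: ax Di)
  have "wirt k (wirt_bar l potential) w
     = (\<Sum>m\<in>UNIV. ((of_real (\<eta> m w) * cnj (D m (axis k 1)) + of_real (\<epsilon> w m (axis k 1)) * cnj (\<Lambda> w m (axis l 1)))
        - \<i> * (of_real (\<eta> m w) * cnj (D m (axis k \<i>)) + of_real (\<epsilon> w m (axis k \<i>)) * cnj (\<Lambda> w m (axis l 1)))) / 2)"
    by (simp only: wirt_def fd sum_distrib_left sum_subtractf[symmetric] sum_divide_distrib)
  also have "\<dots> = (\<Sum>m\<in>UNIV. (of_real (\<epsilon> w m (axis k 1)) - \<i> * of_real (\<epsilon> w m (axis k \<i>))) / 2 * cnj (\<Lambda> w m (axis l 1)))"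
    by (intro sum.cong refl) (simp add: Dax algebra_simps)
  finally show ?thesis .
qed

lemma linear_\<epsilon>: "w \<in> U \<Longrightarrow> linear (\<lambda>x. complex_of_real (\<epsilon> w m x))"
  using linear_compose[OF has_derivative_linear[OF deriv_\<eta>] bounded_linear.linear[OF bounded_linear_of_real]]
  by (simp add: o_def)

text \<open>
  By \<open>wirt_wirt_bar_potential\<close>, \<open>\<partial>\<partial>\<close>-bar pairs the complex linear part of \<open>d\<eta>\<close> with \<open>cnj \<Lambda>\<close>; call this
  \<open>Q\<close>.  Expanding it in the symmetric form \<open>S\<close>, the terms \<open>S w x y\<close> and \<open>S w (\<i> x) (\<i> y)\<close> cancel upon
  antisymmetrization and the mixed ones remain.
\<close>

theorem ddbar_potential:
  assumes w: "w \<in> U"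
  shows "\<i> * ddbar potential w x y = flat_form (s' w x) (s' w y)"
proof -
  define E where "E m k = (complex_of_real (\<epsilon> w m (axis k 1)) - \<i> * of_real (\<epsilon> w m (axis k \<i>))) / 2" for m k
  have E: "(\<Sum>k\<in>UNIV. E m k * x $ k) = (of_real (\<epsilon> w m x) - \<i> * of_real (\<epsilon> w m (\<i> *s x))) / 2" for m x
    unfolding E_def by (rule wirtinger_expansion[OF linear_\<epsilon>[OF w]])
  have L: "(\<Sum>l\<in>UNIV. cnj (\<Lambda> w m (axis l 1)) * cnj (y $ l)) = cnj (\<Lambda> w m y)" for m y
  proof -
    have ax: "axis l \<i> = \<i> *s axis l 1" for l :: 'd
      by (simp add: vec_eq_iff axis_def)
    have "(\<Lambda> w m (axis l 1) - \<i> * \<Lambda> w m (axis l \<i>)) / 2 = \<Lambda> w m (axis l 1)" for l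
      by (simp add: ax \<Lambda>_i[OF w])
    then have "(\<Sum>l\<in>UNIV. \<Lambda> w m (axis l 1) * y $ l) = (\<Lambda> w m y - \<i> * \<Lambda> w m (\<i> *s y)) / 2"
      using wirtinger_expansion[OF linear_\<Lambda>[OF w], of m y] by (simp only:)
    also have "\<dots> = \<Lambda> w m y"
      by (simp add: \<Lambda>_i[OF w])
    finally show ?thesis
      by (metis (no_types, lifting) cnj_sum complex_cnj_mult sum.cong)
  qed
  define Q where "Q x y = (\<Sum>m\<in>UNIV. (of_real (\<epsilon> w m x) - \<i> * of_real (\<epsilon> w m (\<i> *s x))) / 2 * cnj (\<Lambda> w m y))" for x y
  have Q: "(\<Sum>k\<in>UNIV. \<Sum>l\<in>UNIV. (\<Sum>m\<in>UNIV. E m k * cnj (\<Lambda> w m (axis l 1))) * (x $ k * cnj (y $ l))) = Q x y" for x y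
  proof -
    have "Q x y = (\<Sum>m\<in>UNIV. (\<Sum>k\<in>UNIV. E m k * x $ k) * (\<Sum>l\<in>UNIV. cnj (\<Lambda> w m (axis l 1)) * cnj (y $ l)))"
      by (simp only: Q_def E L)
    also have "\<dots> = (\<Sum>m\<in>UNIV. \<Sum>k\<in>UNIV. \<Sum>l\<in>UNIV. E m k * cnj (\<Lambda> w m (axis l 1)) * (x $ k * cnj (y $ l)))"
      by (simp only: sum_product mult_ac)
    also have "\<dots> = (\<Sum>k\<in>UNIV. \<Sum>m\<in>UNIV. \<Sum>l\<in>UNIV. E m k * cnj (\<Lambda> w m (axis l 1)) * (x $ k * cnj (y $ l)))"
      by (rule sum.swap)
    also have "\<dots> = (\<Sum>k\<in>UNIV. \<Sum>l\<in>UNIV. \<Sum>m\<in>UNIV. E m k * cnj (\<Lambda> w m (axis l 1)) * (x $ k * cnj (y $ l)))"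
      by (intro sum.cong refl sum.swap)
    finally show ?thesis
      by (simp only: sum_distrib_right)
  qed
  have "ddbar potential w x y = Q x y - Q y x"
    unfolding ddbar_def wirt_wirt_bar_potential[OF w] E_def[symmetric] Q[symmetric] right_diff_distrib sum_subtractf ..
  moreover have "Q x y = (of_real (S w x y) + \<i> * of_real (S w x (\<i> *s y))
      - \<i> * (of_real (S w (\<i> *s x) y) + \<i> * of_real (S w (\<i> *s x) (\<i> *s y)))) / 2" for x y
  proof -
    have P: "(\<Sum>m\<in>UNIV. of_real (\<epsilon> w m x) * cnj (\<Lambda> w m y)) = of_real (S w x y) + \<i> * of_real (S w x (\<i> *s y))" for x
    proof -
      have "(\<Sum>m\<in>UNIV. of_real (\<epsilon> w m x) * cnj (\<Lambda> w m y))
          = of_real (\<Sum>m\<in>UNIV. \<epsilon> w m x * Re (\<Lambda> w m y)) - \<i> * of_real (\<Sum>m\<in>UNIV. \<epsilon> w m x * Im (\<Lambda> w m y))"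
        by (simp add: complex_eq_iff sum_negf)
      then show ?thesis
        by (simp add: \<epsilon>_Re_\<Lambda>[OF w] \<epsilon>_Im_\<Lambda>_eq_S[OF w])
    qed
    have "Q x y = (\<Sum>m\<in>UNIV. (of_real (\<epsilon> w m x) * cnj (\<Lambda> w m y) - \<i> * (of_real (\<epsilon> w m (\<i> *s x)) * cnj (\<Lambda> w m y))) / 2)"
      unfolding Q_def by (intro sum.cong refl) (simp add: algebra_simps)
    also have "\<dots> = ((\<Sum>m\<in>UNIV. of_real (\<epsilon> w m x) * cnj (\<Lambda> w m y))
        - \<i> * (\<Sum>m\<in>UNIV. of_real (\<epsilon> w m (\<i> *s x)) * cnj (\<Lambda> w m y))) / 2"
      by (simp only: sum_divide_distrib[symmetric] sum_subtractf sum_distrib_left)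
    finally show ?thesis
      by (simp only: P)
  qed
  ultimately have "ddbar potential w x y = \<i> * of_real (S w x (\<i> *s y) - S w y (\<i> *s x))"
    by (simp add: S_sym[of w "\<i> *s x" y] S_sym[of w y x] S_sym[of w "\<i> *s y" x]
        S_sym[of w "\<i> *s y" "\<i> *s x"] algebra_simps add_divide_distrib diff_divide_distrib)
  then show ?thesis
    unfolding flat_form_S[OF w] by (simp flip: mult.assoc)
qed

end

section \<open>The potential in arbitrary holomorphic coordinates\<close>

lemma frechet_derivative_cong_open:
  assumes "open U" "w \<in> U" "\<And>x. x \<in> U \<Longrightarrow> f x = g x"
  shows "frechet_derivative f (at w) = frechet_derivative g (at w)"
proof -
  have "(f has_derivative D) (at w) \<longleftrightarrow> (g has_derivative D) (at w)" for D
    using has_derivative_transform_within_open[of f D w UNIV U g]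
      has_derivative_transform_within_open[of g D w UNIV U f] assms by auto
  then show ?thesis
    by (simp add: frechet_derivative_def)
qed

lemma ddbar_cong_open:
  assumes U: "open U" "w \<in> U" and eq: "\<And>x. x \<in> U \<Longrightarrow> f x = g x"
  shows "ddbar f w x y = ddbar g w x y"
proof -
  have "wirt_bar l f v = wirt_bar l g v" if "v \<in> U" for l v
    by (simp only: wirt_bar_def frechet_derivative_cong_open[OF U(1) that eq])
  then have "frechet_derivative (wirt_bar l f) (at w) = frechet_derivative (wirt_bar l g) (at w)" for l
    by (rule frechet_derivative_cong_open[OF U])
  then show ?thesis
    by (simp only: ddbar_def wirt_def)
qed

definition kaehler_potential ::
  "('n::finite \<Rightarrow> real ^ 'd) \<Rightarrow> ('n \<Rightarrow> real) \<Rightarrow> (real ^ 'd) \<Rightarrow>\<^sub>L real \<Rightarrow> complex" where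
  "kaehler_potential u lam = (\<lambda>\<eta>. complex_of_real (\<Sum>j\<in>UNIV.
      lam j * ln (blinfun_apply \<eta> (u j) - lam j) + blinfun_apply \<eta> (u j)))"

context toric_data begin

lemma hol_param_lift_properties:
  assumes hp: "hol_param L u lam U s" and w: "w \<in> U"
  shows "(s has_derivative frechet_derivative s (at w)) (at w)"
    and "s w \<in> level_set u lam" and "s w $ j \<noteq> 0"
    and "frechet_derivative s (at w) x \<in> level_tangent u (s w)"
proof -
  have U: "open U" and level: "\<And>w. w \<in> U \<Longrightarrow> s w \<in> level_set u lam"
    and "orbit_proj L u (s w) \<in> M_open L u lam" and diff: "s differentiable (at w)"
    using hp w by (auto simp: hol_param_def)
  then show "s w $ j \<noteq> 0"
    using w by (simp add: orbit_proj_M_open)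
  show d: "(s has_derivative frechet_derivative s (at w)) (at w)"
    using diff by (simp add: frechet_derivative_works)
  show "s w \<in> level_set u lam"
    by (rule level[OF w])
  show "frechet_derivative s (at w) x \<in> level_tangent u (s w)"
    by (rule derivative_level_tangent[OF U w d level])
qed

text \<open>
  Complex linearity of the differential of a parametrization is formulated with the reduced
  complex structure; its value on a tangent vector is found from a horizontal representative.
\<close>

lemma hol_param_log_diff_i:
  assumes hp: "hol_param L u lam U s" and w: "w \<in> U"
  shows "log_diff u (s w) (frechet_derivative s (at w) (\<i> *s x)) = \<i> *s log_diff u (s w) (frechet_derivative s (at w) x)"
proof -
  note props = hol_param_lift_properties[OF hp w]
  let ?v = "frechet_derivative s (at w) x" and ?v' = "frechet_derivative s (at w) (\<i> *s x)"
  obtain X where X: "X \<in> lie_K u" and h: "?v + inf_act X (s w) \<in> horizontal u (s w)"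
    using horizontal_representative[OF props(4)] by blast
  have log: "log_diff u (s w) (\<i> *s (?v + inf_act X (s w))) = \<i> *s log_diff u (s w) ?v"
    by (simp only: log_diff_scalar log_diff_add log_diff_inf_act[OF X props(3)] add_0_right)
  have "d_proj L u (s w) ?v' = J_red L u lam (d_proj L u (s w) ?v)"
    using hp w by (simp add: hol_param_def)
  also have "\<dots> = d_proj L u (s w) (\<i> *s (?v + inf_act X (s w)))"
    by (rule J_red_d_proj[OF props(2,3,4) horizontal_imag_tangent[OF h] log])
  finally show ?thesis
    unfolding d_proj_eq_iff_log_diff[OF props(3,4) horizontal_imag_tangent[OF h]] log .
qed

text \<open>
  The value in an arbitrary parametrization is the flat form on the lifted tangent vectors, which
  does not depend on the parametrization.
\<close>

lemma hol_param_ddbar: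
  assumes hp: "hol_param L u lam U s" and w: "w \<in> U"
  shows "\<i> * ddbar (\<lambda>w'. (kaehler_potential u lam \<circ> moment_P u lam) (orbit_proj L u (s w'))) w x y
    = flat_form (frechet_derivative s (at w) x) (frechet_derivative s (at w) y)"
proof -
  obtain R where R: "\<And>x. (\<Sum>j\<in>UNIV. (blinfun_apply R x $ j) *\<^sub>R u j) = x"
    using A_map_right_inverse by blast
  note props = hol_param_lift_properties[OF hp]
  interpret holomorphic_lift L u lam U s "\<lambda>w. frechet_derivative s (at w)" R
  proof
    show "open U" "\<And>x. continuous_on U (\<lambda>w. frechet_derivative s (at w) x)"
      using hp by (auto simp: hol_param_def)
  qed (use props hol_param_log_diff_i[OF hp] R in auto)
  have "ddbar (\<lambda>w'. (kaehler_potential u lam \<circ> moment_P u lam) (orbit_proj L u (s w'))) w x y = ddbar potential w x y"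
    by (rule ddbar_cong_open[OF open_U w])
       (simp add: kaehler_potential_def potential_def moment_P_orbit_proj[OF level])
  then show ?thesis
    using ddbar_potential[OF w] by simp
qed

end

section \<open>Existence of holomorphic coordinates\<close>

lemma continuous_on_det:
  fixes A :: "'a::topological_space \<Rightarrow> real ^ 'n::finite ^ 'n"
  assumes "\<And>i j. continuous_on V (\<lambda>y. A y $ i $ j)"
  shows "continuous_on V (\<lambda>y. det (A y))"
  unfolding det_def
  by (intro continuous_on_sum continuous_on_mult continuous_on_prod continuous_on_const assms)

text \<open>
  By Cramer's rule the solution of a linear system is a quotient of determinants.
\<close>

lemma continuous_on_inverse_linear:
  fixes F :: "'a::topological_space \<Rightarrow> real ^ 'd::finite \<Rightarrow> real ^ 'd"
  assumes lin: "\<And>y. y \<in> V \<Longrightarrow> linear (F y)" and inj: "\<And>y. y \<in> V \<Longrightarrow> inj (F y)"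
    and cont: "\<And>x. continuous_on V (\<lambda>y. F y x)"
    and G: "\<And>y. y \<in> V \<Longrightarrow> F y (G y) = x"
  shows "continuous_on V G"
proof -
  define M where "M y = matrix (F y)" for y
  have M: "continuous_on V (\<lambda>y. M y $ i $ j)" for i j
    unfolding M_def matrix_def by (simp add: continuous_on_component[OF cont])
  have nz: "det (M y) \<noteq> 0" if "y \<in> V" for y
    unfolding M_def using det_nz_iff_inj[OF lin[OF that]] inj[OF that] by blast
  have entry: "continuous_on V (\<lambda>y. (\<chi> i j. if j = k then x $ i else M y $ i $ j) $ i $ j)" for i j k
    by (cases "j = k") (simp_all add: M)
  have "continuous_on V (\<lambda>y. \<chi> k. det (\<chi> i j. if j = k then x $ i else M y $ i $ j) / det (M y))"
    by (intro continuous_on_vec_lambda continuous_on_divide continuous_on_det entry M ballI nz)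
  moreover have "G y = (\<chi> k. det (\<chi> i j. if j = k then x $ i else M y $ i $ j) / det (M y))" if y: "y \<in> V" for y
  proof -
    have "M y *v G y = x"
      unfolding M_def by (simp add: matrix_works linear_matrix_vector_mul_eq lin[OF y] G[OF y])
    then show ?thesis
      using cramer[OF nz[OF y]] by blast
  qed
  ultimately show ?thesis
    by (simp cong: continuous_on_cong)
qed

lemma has_derivative_vec_lambda:
  fixes f :: "'a::real_normed_vector \<Rightarrow> 'n::finite \<Rightarrow> complex"
  assumes "\<And>j. ((\<lambda>x. f x j) has_derivative (\<lambda>h. f' h j)) (at a)"
  shows "((\<lambda>x. \<chi> j. f x j) has_derivative (\<lambda>h. \<chi> j. f' h j)) (at a)"
proof (subst has_derivative_componentwise_within, rule ballI)
  fix b :: "complex ^ 'n" assume "b \<in> Basis"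
  then obtain i k where b: "b = axis i k"
    by (auto simp: Basis_vec_def)
  show "((\<lambda>x. (\<chi> j. f x j) \<bullet> b) has_derivative (\<lambda>h. (\<chi> j. f' h j) \<bullet> b)) (at a)"
    unfolding b inner_axis by (simp add: has_derivative_inner_left[OF assms])
qed

definition re_vec :: "complex ^ 'd \<Rightarrow> real ^ 'd" where
  "re_vec w = (\<chi> m. Re (w $ m))"

definition im_vec :: "complex ^ 'd \<Rightarrow> real ^ 'd" where
  "im_vec w = (\<chi> m. Im (w $ m))"

lemma bounded_linear_re_vec: "bounded_linear (re_vec :: complex ^ 'd::finite \<Rightarrow> real ^ 'd)"
  unfolding linear_conv_bounded_linear[symmetric] re_vec_def by (rule linearI) (simp_all add: vec_eq_iff)

lemma bounded_linear_im_vec: "bounded_linear (im_vec :: complex ^ 'd::finite \<Rightarrow> real ^ 'd)"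
  unfolding linear_conv_bounded_linear[symmetric] im_vec_def by (rule linearI) (simp_all add: vec_eq_iff)

lemma re_im_vec_eqI: "re_vec v = re_vec w \<Longrightarrow> im_vec v = im_vec w \<Longrightarrow> v = w"
  by (simp add: vec_eq_iff re_vec_def im_vec_def complex_eq_iff)

context toric_data begin

lemma eq_if_inner_u_eq:
  assumes "\<And>j. x \<bullet> u j = y \<bullet> u j"
  shows "x = y"
proof -
  have "span (range u) \<subseteq> {v. (x - y) \<bullet> v = 0}"
    by (intro span_minimal subspace_hyperplane) (auto simp: inner_diff_left assms)
  then have "(x - y) \<bullet> (x - y) = 0"
    unfolding span_u by blast
  then show ?thesis by simp
qed

text \<open>
  The gradient of \<open>1/2 \<Sum>j. (l\<^sub>j ln l\<^sub>j - l\<^sub>j)\<close> with \<open>l\<^sub>j = e \<bullet> u\<^sub>j - lam\<^sub>j\<close>.  If \<open>e\<close> represents the value of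
  the moment map at a point \<open>z\<close>, this is \<open>\<Sum>j. ln \<bar>z\<^sub>j\<bar> u\<^sub>j\<close>, the real part of the holomorphic
  coordinate.
\<close>

definition legendre :: "('n \<Rightarrow> real) \<Rightarrow> real ^ 'd \<Rightarrow> real ^ 'd" where
  "legendre lam e = (\<Sum>j\<in>UNIV. (ln (e \<bullet> u j - lam j) / 2) *\<^sub>R u j)"

definition legendre_deriv :: "('n \<Rightarrow> real) \<Rightarrow> real ^ 'd \<Rightarrow> (real ^ 'd) \<Rightarrow>\<^sub>L (real ^ 'd)" where
  "legendre_deriv lam e = (\<Sum>j\<in>UNIV. (1 / (2 * (e \<bullet> u j - lam j))) *\<^sub>R Blinfun (\<lambda>x. (x \<bullet> u j) *\<^sub>R u j))"

lemma legendre_deriv_apply: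
  "blinfun_apply (legendre_deriv lam e) x = (\<Sum>j\<in>UNIV. (x \<bullet> u j / (2 * (e \<bullet> u j - lam j))) *\<^sub>R u j)"
proof -
  have "bounded_linear (\<lambda>x. (x \<bullet> u j) *\<^sub>R u j)" for j
    by (intro bounded_linear_scaleR_const bounded_linear_inner_left)
  then show ?thesis
    by (simp add: legendre_deriv_def blinfun.sum_left blinfun.scaleR_left bounded_linear_Blinfun_apply)
qed

lemma has_derivative_legendre:
  assumes "\<And>j. lam j < e \<bullet> u j"
  shows "(legendre lam has_derivative blinfun_apply (legendre_deriv lam e)) (at e)"
  unfolding legendre_def[abs_def] legendre_deriv_apply[abs_def]
proof (intro has_derivative_sum has_derivative_scaleR_left)
  fix j
  have pos: "0 < e \<bullet> u j - lam j" using assms[of j] by simp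
  have a: "((\<lambda>e. e \<bullet> u j - lam j) has_derivative (\<lambda>x. x \<bullet> u j - 0)) (at e)"
    by (intro has_derivative_diff has_derivative_inner_left has_derivative_ident has_derivative_const)
  have "(ln has_derivative (*) (inverse (e \<bullet> u j - lam j))) (at (e \<bullet> u j - lam j))"
    using DERIV_ln[OF pos] by (simp only: has_field_derivative_def)
  note d = bounded_linear.has_derivative[OF bounded_linear_divide[of 2] has_derivative_compose[OF a this]]
  have "(\<lambda>x. inverse (e \<bullet> u j - lam j) * (x \<bullet> u j - 0) / 2) = (\<lambda>x. x \<bullet> u j / (2 * (e \<bullet> u j - lam j)))"
    by (simp only: fun_eq_iff divide_inverse inverse_mult_distrib diff_zero mult_ac simp_thms)
  with d show "((\<lambda>e. ln (e \<bullet> u j - lam j) / 2) has_derivative (\<lambda>x. x \<bullet> u j / (2 * (e \<bullet> u j - lam j)))) (at e)"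
    by (simp only:)
qed

text \<open>
  The derivative is the symmetric form \<open>1/2 \<Sum>j. (x \<bullet> u\<^sub>j)\<^sup>2 / l\<^sub>j\<close>, positive definite since the \<open>u\<^sub>j\<close>
  span.
\<close>

lemma legendre_deriv_inj:
  assumes "\<And>j. lam j < e \<bullet> u j"
  shows "inj (blinfun_apply (legendre_deriv lam e))"
proof (rule linear_injective_0[THEN iffD2, rule_format])
  show "linear (blinfun_apply (legendre_deriv lam e))"
    by (simp add: blinfun.bounded_linear_right bounded_linear.linear)
  fix x assume "blinfun_apply (legendre_deriv lam e) x = 0"
  then have "x \<bullet> (\<Sum>j\<in>UNIV. (x \<bullet> u j / (2 * (e \<bullet> u j - lam j))) *\<^sub>R u j) = 0"
    by (simp add: legendre_deriv_apply)
  then have "(\<Sum>j\<in>UNIV. (x \<bullet> u j)\<^sup>2 / (2 * (e \<bullet> u j - lam j))) = 0"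
    by (simp only: inner_sum_right inner_scaleR_right power2_eq_square times_divide_eq_left)
  moreover have "0 \<le> (x \<bullet> u j)\<^sup>2 / (2 * (e \<bullet> u j - lam j))" for j
    using assms[of j] by (intro divide_nonneg_pos) auto
  ultimately have "(x \<bullet> u j)\<^sup>2 / (2 * (e \<bullet> u j - lam j)) = 0" for j
    by (subst (asm) sum_nonneg_eq_0_iff) auto
  moreover have "2 * (e \<bullet> u j - lam j) \<noteq> 0" for j
    using assms[of j] by simp
  ultimately have "x \<bullet> u j = 0" for j
    by (metis divide_eq_0_iff power_eq_0_iff)
  then show "x = 0"
    using eq_if_inner_u_eq[of x 0] by simp
qed

lemma open_positive: "open {e. \<forall>j. lam j < e \<bullet> u j}"
proof -
  have "{e. \<forall>j. lam j < e \<bullet> u j} = (\<Inter>j. {e. lam j < e \<bullet> u j})"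
    by auto
  also have "open \<dots>"
    by (intro open_INT ballI open_Collect_less continuous_intros) auto
  finally show ?thesis .
qed

lemma continuous_on_legendre_deriv:
  "continuous_on {e. \<forall>j. lam j < e \<bullet> u j} (legendre_deriv lam)"
  unfolding legendre_deriv_def[abs_def]
  by (intro continuous_on_sum continuous_on_scaleR continuous_on_const continuous_on_divide continuous_on_mult
      continuous_on_diff continuous_on_inner continuous_on_id) (auto, metis order_less_irrefl)

text \<open>
  The inverse function theorem, together with continuity of the derivative of the inverse, which
  is required of a holomorphic parametrization.
\<close>

lemma legendre_local_inverse:
  assumes e0: "\<And>j. lam j < e0 \<bullet> u j"
  obtains V g g' where "open V" "legendre lam e0 \<in> V" "g (legendre lam e0) = e0"
    "\<And>y j. y \<in> V \<Longrightarrow> lam j < g y \<bullet> u j"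
    "\<And>y. y \<in> V \<Longrightarrow> legendre lam (g y) = y"
    "\<And>y. y \<in> V \<Longrightarrow> (g has_derivative g' y) (at y)"
    "\<And>y x. y \<in> V \<Longrightarrow> blinfun_apply (legendre_deriv lam (g y)) (g' y x) = x"
    "\<And>x. continuous_on V (\<lambda>y. g' y x)"
proof -
  let ?W = "{e. \<forall>j. lam j < e \<bullet> u j}"
  have lin: "linear (blinfun_apply (legendre_deriv lam e))" for e
    by (simp add: blinfun.bounded_linear_right bounded_linear.linear)
  obtain i where i: "linear i" "i \<circ> blinfun_apply (legendre_deriv lam e0) = id"
    using linear_injective_left_inverse[OF lin legendre_deriv_inj[OF e0]] by blast
  have left_inv: "Blinfun i o\<^sub>L legendre_deriv lam e0 = id_blinfun"
    using i by (intro blinfun_eqI) (simp add: bounded_linear_Blinfun_apply linear_conv_bounded_linear fun_eq_iff)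
  have der: "(legendre lam has_derivative blinfun_apply (legendre_deriv lam e)) (at e)" if "e \<in> ?W" for e
    using that by (intro has_derivative_legendre) auto
  have e0W: "e0 \<in> ?W"
    using e0 by simp
  show thesis
  proof (rule inverse_function_theorem[OF open_positive der continuous_on_legendre_deriv e0W left_inv], assumption)
    fix U' V g g'
    assume U': "open U'" "U' \<subseteq> ?W" "e0 \<in> U'" and V: "open V" "legendre lam e0 \<in> V"
      and hom: "homeomorphism U' V (legendre lam) g"
      and dg: "\<And>y. y \<in> V \<Longrightarrow> (g has_derivative g' y) (at y)"
      and g': "\<And>y. y \<in> V \<Longrightarrow> g' y = inv (blinfun_apply (legendre_deriv lam (g y)))"
      and bij: "\<And>y. y \<in> V \<Longrightarrow> bij (blinfun_apply (legendre_deriv lam (g y)))"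
    have gU: "g y \<in> U'" if "y \<in> V" for y
      using hom that by (auto simp: homeomorphism_def)
    then have gW: "g y \<in> ?W" if "y \<in> V" for y
      using U'(2) that by auto
    have inv: "blinfun_apply (legendre_deriv lam (g y)) (g' y x) = x" if "y \<in> V" for y x
      unfolding g'[OF that] by (rule surj_f_inv_f[OF bij_is_surj[OF bij[OF that]]])
    have cont: "continuous_on V (\<lambda>y. g' y x)" for x
    proof (rule continuous_on_inverse_linear[where F = "\<lambda>y. blinfun_apply (legendre_deriv lam (g y))"])
      have "continuous_on V g"
        using hom by (simp add: homeomorphism_def)
      then have "continuous_on V (\<lambda>y. legendre_deriv lam (g y))"
        using gW by (intro continuous_on_compose2[OF continuous_on_legendre_deriv]) auto
      then show "continuous_on V (\<lambda>y. blinfun_apply (legendre_deriv lam (g y)) x)" for x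
        by (intro blinfun.continuous_on continuous_on_const)
    qed (use lin bij inv in \<open>auto intro: bij_is_inj\<close>)
    show thesis
    proof (rule that)
      show "g (legendre lam e0) = e0"
        using hom U'(3) by (simp add: homeomorphism_def)
      show "lam j < g y \<bullet> u j" if "y \<in> V" for y j
        using gW[OF that] by simp
      show "legendre lam (g y) = y" if "y \<in> V" for y
        using hom that by (simp add: homeomorphism_def)
    qed (fact V dg inv cont)+
  qed
qed

lemma mem_level_setI_inner:
  assumes "\<And>j. (cmod (z $ j))\<^sup>2 + lam j = e \<bullet> u j"
  shows "z \<in> level_set u lam"
  unfolding mem_level_set
proof
  fix X assume "X \<in> lie_K u"
  then have "e \<bullet> (\<Sum>j\<in>UNIV. (X $ j) *\<^sub>R u j) = 0"
    by (simp add: mem_lie_K)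
  then show "(\<Sum>j\<in>UNIV. ((cmod (z $ j))\<^sup>2 + lam j) * X $ j) = 0"
    by (simp add: assms inner_sum_right mult.commute)
qed

lemma level_set_inner:
  assumes "z \<in> level_set u lam"
  obtains e where "\<And>j. (cmod (z $ j))\<^sup>2 + lam j = e \<bullet> u j"
proof -
  obtain R where R: "\<And>x. (\<Sum>j\<in>UNIV. (blinfun_apply R x $ j) *\<^sub>R u j) = x"
    using A_map_right_inverse by blast
  define e :: "real ^ 'd" where "e = (\<chi> m. \<Sum>j\<in>UNIV. ((cmod (z $ j))\<^sup>2 + lam j) * blinfun_apply R (axis m 1) $ j)"
  have "(cmod (z $ i))\<^sup>2 + lam i = e \<bullet> u i" for i
  proof -
    have "(\<Sum>j\<in>UNIV. ((cmod (z $ j))\<^sup>2 + lam j) * (if j = i then 1 else 0))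
        = (\<Sum>m\<in>UNIV. e $ m * (\<Sum>j\<in>UNIV. (if j = i then 1 else 0) *\<^sub>R u j) $ m)"
      unfolding e_def vec_lambda_beta
      by (rule lie_K_annihilator_descends[OF R]) (use assms in \<open>simp add: mem_level_set\<close>)
    then show ?thesis
      by (simp add: inner_vec_def if_distrib[of "\<lambda>c. _ * c"] if_distrib[of "\<lambda>c. c *\<^sub>R _"]
          if_distrib[of "\<lambda>c. c * _"] cong: if_cong)
  qed
  then show thesis
    by (rule that)
qed

text \<open>
  The parametrization assigns to \<open>w\<close> a point of the level set at which the holomorphic coordinate
  \<open>\<Sum>j. log (z\<^sub>j) u\<^sub>j\<close> is \<open>w\<close> up to a constant: the moduli are those for which the Legendre map takes
  the value \<open>Re w\<close>, and the phases are a preimage of \<open>Im w\<close> under \<open>A\<close> on top of those of \<open>z0\<close>.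
  Then \<open>log_diff\<close> inverts the differential, from which bijectivity and complex linearity on tangent
  spaces follow.  Two points of the same orbit have the same moduli, hence the same \<open>Re w\<close>, and
  their imaginary parts differ by \<open>2 pi\<close> times a lattice vector, hence are equal if the imaginary
  parts are restricted to a small ball.
\<close>

lemma hol_param_exists:
  assumes z0: "z0 \<in> level_set u lam" and nz: "\<And>j. z0 $ j \<noteq> 0"
  obtains U s w0 where "hol_param L u lam U s" "w0 \<in> U" "s w0 = z0"
proof -
  obtain e0 where e0: "\<And>j. (cmod (z0 $ j))\<^sup>2 + lam j = e0 \<bullet> u j"
    using level_set_inner[OF z0] by blast
  have e0_pos: "lam j < e0 \<bullet> u j" for j
  proof -
    have "0 < (cmod (z0 $ j))\<^sup>2"
      using nz[of j] by simp
    then show ?thesis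
      using e0[of j] by linarith
  qed
  show thesis
  proof (rule legendre_local_inverse[of lam e0, OF e0_pos])
    fix V g g'
    assume V: "open V" "legendre lam e0 \<in> V" and g0: "g (legendre lam e0) = e0"
      and pos: "\<And>y j. y \<in> V \<Longrightarrow> lam j < g y \<bullet> u j"
      and leg: "\<And>y. y \<in> V \<Longrightarrow> legendre lam (g y) = y"
      and dg: "\<And>y. y \<in> V \<Longrightarrow> (g has_derivative g' y) (at y)"
      and inv: "\<And>y x. y \<in> V \<Longrightarrow> blinfun_apply (legendre_deriv lam (g y)) (g' y x) = x"
      and cont_g': "\<And>x. continuous_on V (\<lambda>y. g' y x)"
    obtain R where R: "\<And>x. (\<Sum>j\<in>UNIV. (blinfun_apply R x $ j) *\<^sub>R u j) = x"
      using A_map_right_inverse by blast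
    obtain \<delta> where \<delta>: "0 < \<delta>" "\<And>x. x \<in> L \<Longrightarrow> norm x < \<delta> \<Longrightarrow> x = 0"
      using lattice_discrete[OF lattice] by blast
    \<comment> \<open>The difference of two imaginary parts is shorter than \<open>2 * pi * \<delta>\<close>, so it is \<open>2 * pi\<close> times a
      lattice vector only if it is zero.\<close>
    define U where "U = {w. re_vec w \<in> V \<and> norm (im_vec w) < pi * \<delta>}"
    define \<rho> where "\<rho> j w = g (re_vec w) \<bullet> u j - lam j" for j w
    define \<theta> where "\<theta> j w = blinfun_apply R (im_vec w) $ j" for j w
    define s where "s w = (\<chi> j. exp (of_real (ln (\<rho> j w) / 2) + \<i> * of_real (\<theta> j w)) * sgn (z0 $ j))" for w
    define q where "q w x j = of_real (g' (re_vec w) (re_vec x) \<bullet> u j / (2 * \<rho> j w)) + \<i> * of_real (\<theta> j x)" for w x j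
    define s' where "s' w x = (\<chi> j. s w $ j * q w x j)" for w x
    have \<rho>_pos: "0 < \<rho> j w" if "w \<in> U" for w j
      using pos[of "re_vec w" j] that by (simp add: \<rho>_def U_def)
    have s_nz: "s w $ j \<noteq> 0" for w j
      using nz[of j] by (simp add: s_def sgn_zero_iff)
    have norm_s: "(cmod (s w $ j))\<^sup>2 = \<rho> j w" if "w \<in> U" for w j
    proof -
      have "cmod (s w $ j) = exp (ln (\<rho> j w) / 2)"
        using nz[of j] by (simp add: s_def norm_mult norm_sgn)
      then have "(cmod (s w $ j))\<^sup>2 = exp (ln (\<rho> j w))"
        by (simp add: power2_eq_square flip: exp_add)
      then show ?thesis
        using \<rho>_pos[OF that] by simp
    qed
    have level: "s w \<in> level_set u lam" if "w \<in> U" for w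
      by (rule mem_level_setI_inner[of _ _ "g (re_vec w)"]) (simp add: norm_s[OF that] \<rho>_def)
    have open_U: "open U"
    proof -
      have "U = re_vec -` V \<inter> (\<lambda>w. norm (im_vec w)) -` {..<pi * \<delta>}"
        by (auto simp: U_def)
      also have "open \<dots>"
        by (intro open_Int open_vimage V(1) open_lessThan continuous_on_norm
            linear_continuous_on bounded_linear_re_vec bounded_linear_im_vec)
      finally show ?thesis .
    qed
    have bl_\<theta>: "bounded_linear (\<theta> j)" for j
      unfolding \<theta>_def[abs_def]
      by (intro bounded_linear_compose[OF bounded_linear_vec_nth]
          bounded_linear_compose[OF blinfun.bounded_linear_right] bounded_linear_im_vec)
    have d\<rho>: "(\<rho> j has_derivative (\<lambda>x. g' (re_vec w) (re_vec x) \<bullet> u j)) (at w)" if "w \<in> U" for w j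
    proof -
      have "re_vec w \<in> V" using that by (simp add: U_def)
      from has_derivative_compose[OF bounded_linear_imp_has_derivative[OF bounded_linear_re_vec] dg[OF this]]
      have "((\<lambda>w. g (re_vec w) \<bullet> u j - lam j) has_derivative (\<lambda>x. g' (re_vec w) (re_vec x) \<bullet> u j - 0)) (at w)"
        by (intro has_derivative_diff has_derivative_inner_left has_derivative_const)
      then show ?thesis
        by (simp add: \<rho>_def[abs_def])
    qed
    have ds: "(s has_derivative s' w) (at w)" if w: "w \<in> U" for w
      unfolding s_def[abs_def] s'_def[abs_def]
    proof (rule has_derivative_vec_lambda)
      fix j
      let ?a = "of_real (ln (\<rho> j w) / 2) + \<i> * of_real (\<theta> j w)"
      have "(ln has_derivative (*) (inverse (\<rho> j w))) (at (\<rho> j w))"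
        using DERIV_ln[OF \<rho>_pos[OF w]] by (simp only: has_field_derivative_def)
      note dln = has_derivative_compose[OF d\<rho>[OF w] this]
      have "((\<lambda>w. of_real (ln (\<rho> j w) / 2) + \<i> * of_real (\<theta> j w)) has_derivative
          (\<lambda>x. of_real (inverse (\<rho> j w) * (g' (re_vec w) (re_vec x) \<bullet> u j) / 2) + \<i> * of_real (\<theta> j x))) (at w)"
        by (intro has_derivative_add has_derivative_of_real has_derivative_mult_right
            bounded_linear.has_derivative[OF bounded_linear_divide dln] bounded_linear_imp_has_derivative[OF bl_\<theta>])
      moreover have "inverse (\<rho> j w) * a / 2 = a / (2 * \<rho> j w)" for a
        by (simp only: divide_inverse inverse_mult_distrib mult_ac)
      ultimately have dq: "((\<lambda>w. of_real (ln (\<rho> j w) / 2) + \<i> * of_real (\<theta> j w)) has_derivative (\<lambda>x. q w x j)) (at w)"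
        by (simp only: q_def)
      have "(exp has_derivative (*) (exp ?a)) (at ?a)"
        using DERIV_exp[of ?a] by (simp only: has_field_derivative_def)
      from has_derivative_mult_left[OF has_derivative_compose[OF dq this], of "sgn (z0 $ j)"]
      show "((\<lambda>w. exp (of_real (ln (\<rho> j w) / 2) + \<i> * of_real (\<theta> j w)) * sgn (z0 $ j)) has_derivative
          (\<lambda>x. (\<chi> j. exp (of_real (ln (\<rho> j w) / 2) + \<i> * of_real (\<theta> j w)) * sgn (z0 $ j)) $ j * q w x j)) (at w)"
        by (simp only: vec_lambda_beta mult_ac)
    qed
    have fd: "frechet_derivative s (at w) = s' w" if "w \<in> U" for w
      using frechet_derivative_at[OF ds[OF that]] by simp
    have log: "log_diff u (s w) (s' w x) = x" if w: "w \<in> U" for w x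
    proof -
      have wV: "re_vec w \<in> V" using w by (simp add: U_def)
      have q: "s' w x $ j / s w $ j = q w x j" for j
        using s_nz by (simp add: s'_def)
      have "(\<Sum>j\<in>UNIV. (g' (re_vec w) (re_vec x) \<bullet> u j / (2 * \<rho> j w)) *\<^sub>R u j) = re_vec x"
        using inv[OF wV] by (simp add: legendre_deriv_apply \<rho>_def)
      then have re: "(\<Sum>j\<in>UNIV. Re (q w x j) *\<^sub>R u j) = re_vec x"
        by (simp add: q_def)
      have im: "(\<Sum>j\<in>UNIV. Im (q w x j) *\<^sub>R u j) = im_vec x"
        using R by (simp add: q_def \<theta>_def)
      show ?thesis
        by (rule re_im_vec_eqI) (simp_all add: vec_eq_iff re_vec_def im_vec_def Re_log_diff Im_log_diff q re im
            del: sum_component)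
    qed
    have s'_tangent: "s' w x \<in> level_tangent u (s w)" if w: "w \<in> U" for w x
      by (rule derivative_level_tangent[OF open_U w ds[OF w] level])
    have cont_s: "continuous_on U s"
      by (intro continuous_at_imp_continuous_on ballI has_derivative_continuous[OF ds])
    have cont_s': "continuous_on U (\<lambda>w. s' w x)" for x
    proof -
      have cr: "continuous_on U re_vec"
        by (rule linear_continuous_on[OF bounded_linear_re_vec])
      have c\<rho>: "continuous_on U (\<rho> j)" for j
        by (intro continuous_at_imp_continuous_on ballI has_derivative_continuous[OF d\<rho>])
      have cg': "continuous_on U (\<lambda>w. g' (re_vec w) (re_vec x))"
        by (rule continuous_on_compose2[OF cont_g' cr]) (auto simp: U_def)
      have nz2: "2 * \<rho> j w \<noteq> 0" if "w \<in> U" for j w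
        using \<rho>_pos[OF that, of j] by simp
      show ?thesis
        unfolding s'_def q_def
        by (intro continuous_on_vec_lambda continuous_on_mult continuous_on_component[OF cont_s] continuous_on_add
            continuous_on_of_real continuous_on_divide continuous_on_inner cg' c\<rho> continuous_on_const ballI nz2)
    qed
    have inj: "inj_on (\<lambda>w. orbit_proj L u (s w)) U"
    proof (rule inj_onI)
      fix w w' assume w: "w \<in> U" and w': "w' \<in> U" and "orbit_proj L u (s w) = orbit_proj L u (s w')"
      then obtain t where t: "t \<in> K_lift L u" and eq: "s w' = phase_act t (s w)"
        by (auto simp: orbit_proj_eq_iff)
      have \<rho>_eq: "\<rho> j w' = \<rho> j w" for j
        using norm_s[OF w, of j] norm_s[OF w', of j] by (simp add: eq cmod_phase_act)
      then have "g (re_vec w') = g (re_vec w)"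
        by (intro eq_if_inner_u_eq) (simp add: \<rho>_def)
      then have re: "re_vec w' = re_vec w"
        using w w' leg by (metis (no_types, lifting) U_def mem_Collect_eq)
      have "\<exists>n::int. \<theta> j w' = \<theta> j w + 2 * pi * t $ j + 2 * pi * of_int n" for j
      proof -
        let ?r = "of_real (ln (\<rho> j w) / 2)"
        have "exp (?r + \<i> * of_real (\<theta> j w')) * sgn (z0 $ j)
            = cis (2 * pi * t $ j) * (exp (?r + \<i> * of_real (\<theta> j w)) * sgn (z0 $ j))"
          using arg_cong[OF eq, of "\<lambda>z. z $ j"] by (simp add: s_def phase_act_nth \<rho>_eq)
        then have "exp (?r + \<i> * of_real (\<theta> j w')) = exp (?r + \<i> * of_real (\<theta> j w) + \<i> * of_real (2 * pi * t $ j))"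
          using nz[of j] by (simp only: exp_add cis_conv_exp) (simp add: sgn_zero_iff mult_ac)
        then obtain n :: int where "?r + \<i> * of_real (\<theta> j w')
            = ?r + \<i> * of_real (\<theta> j w) + \<i> * of_real (2 * pi * t $ j) + (of_int (2 * n) * pi) * \<i>"
          by (auto simp only: exp_eq)
        from arg_cong[OF this, of Im] show ?thesis
          by (intro exI[of _ n]) (simp add: mult_ac)
      qed
      then obtain n :: "'n \<Rightarrow> int" where n: "\<And>j. \<theta> j w' = \<theta> j w + 2 * pi * t $ j + 2 * pi * of_int (n j)"
        by metis
      define d where "d = (\<Sum>j\<in>UNIV. (t $ j) *\<^sub>R u j) + (\<Sum>j\<in>UNIV. of_int (n j) *\<^sub>R u j)"
      have "d \<in> L"
        unfolding d_def
      proof (rule lattice_add[OF lattice])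
        show "(\<Sum>j\<in>UNIV. (t $ j) *\<^sub>R u j) \<in> L"
          using t by (simp add: K_lift_def)
        show "(\<Sum>j\<in>UNIV. of_int (n j) *\<^sub>R u j) \<in> L"
          by (intro lattice_sum[OF lattice] lattice_scale_int[OF lattice] u_in)
      qed
      have "im_vec w' = (\<Sum>j\<in>UNIV. \<theta> j w' *\<^sub>R u j)"
        by (simp add: \<theta>_def R)
      also have "\<dots> = (\<Sum>j\<in>UNIV. \<theta> j w *\<^sub>R u j + (2 * pi) *\<^sub>R ((t $ j) *\<^sub>R u j) + (2 * pi) *\<^sub>R (of_int (n j) *\<^sub>R u j))"
        by (intro sum.cong refl) (simp add: n scaleR_add_left)
      also have "\<dots> = im_vec w + (2 * pi) *\<^sub>R d"
        by (simp only: sum.distrib scaleR_sum_right[symmetric] d_def scaleR_add_right) (simp add: \<theta>_def R)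
      finally have im: "im_vec w' - im_vec w = (2 * pi) *\<^sub>R d"
        by simp
      have "2 * pi * norm d = norm (im_vec w' - im_vec w)"
        by (simp add: im)
      also have "\<dots> \<le> norm (im_vec w') + norm (im_vec w)"
        by (rule norm_triangle_ineq4)
      also have "\<dots> < 2 * pi * \<delta>"
        using w w' by (simp add: U_def)
      finally have "norm d < \<delta>"
        by simp
      then have "d = 0"
        using \<delta>(2) \<open>d \<in> L\<close> by blast
      with im have "im_vec w = im_vec w'"
        by simp
      with re show "w = w'"
        by (intro re_im_vec_eqI) simp_all
    qed
    have bij: "bij_betw (\<lambda>x. d_proj L u (s w) (s' w x)) UNIV (M_tangent L u (orbit_proj L u (s w)))" if w: "w \<in> U" for w
      unfolding bij_betw_def
    proof (intro conjI inj_onI subset_antisym subsetI)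
      fix x y assume "d_proj L u (s w) (s' w x) = d_proj L u (s w) (s' w y)"
      then show "x = y"
        using d_proj_eq_iff_log_diff[OF s_nz s'_tangent[OF w] s'_tangent[OF w]] by (simp add: log[OF w])
    next
      fix a assume "a \<in> range (\<lambda>x. d_proj L u (s w) (s' w x))"
      then show "a \<in> M_tangent L u (orbit_proj L u (s w))"
        using s'_tangent[OF w] by (auto simp: mem_M_tangent)
    next
      fix a assume "a \<in> M_tangent L u (orbit_proj L u (s w))"
      then obtain v where v: "v \<in> level_tangent u (s w)" and a: "a = d_proj L u (s w) v"
        by (auto simp: mem_M_tangent)
      have "d_proj L u (s w) v = d_proj L u (s w) (s' w (log_diff u (s w) v))"
        unfolding d_proj_eq_iff_log_diff[OF s_nz v s'_tangent[OF w]] log[OF w] ..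
      then show "a \<in> range (\<lambda>x. d_proj L u (s w) (s' w x))"
        unfolding a by (rule range_eqI)
    qed
    have J: "d_proj L u (s w) (s' w (\<i> *s x)) = J_red L u lam (d_proj L u (s w) (s' w x))" if w: "w \<in> U" for w x
      by (rule J_red_d_proj[OF level[OF w] s_nz s'_tangent[OF w] s'_tangent[OF w], symmetric]) (simp add: log[OF w])
    have hp: "hol_param L u lam U s"
      unfolding hol_param_def
    proof (intro conjI ballI allI)
      show "s ` U \<subseteq> level_set u lam"
        using level by blast
      show "(\<lambda>w. orbit_proj L u (s w)) ` U \<subseteq> M_open L u lam"
        using orbit_proj_M_open[OF level] s_nz by blast
      show "s differentiable (at w)" if "w \<in> U" for w
        using ds[OF that] by (rule differentiableI)
      show "continuous_on U (\<lambda>w. frechet_derivative s (at w) x)" for x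
        using cont_s'[of x] by (simp add: fd cong: continuous_on_cong)
    qed (use open_U inj bij J fd in simp_all)
    define w0 where "w0 = (\<chi> m. complex_of_real (legendre lam e0 $ m))"
    have re0: "re_vec w0 = legendre lam e0" and im0: "im_vec w0 = 0"
      by (simp_all add: w0_def re_vec_def im_vec_def vec_eq_iff)
    have w0: "w0 \<in> U"
      using V(2) \<delta>(1) by (simp add: U_def re0 im0)
    have "s w0 $ j = z0 $ j" for j
    proof -
      have "\<rho> j w0 = (cmod (z0 $ j))\<^sup>2"
        using e0[of j] by (simp add: \<rho>_def re0 g0)
      then have "ln (\<rho> j w0) / 2 = ln (cmod (z0 $ j))"
        using nz[of j] by (simp add: ln_realpow)
      moreover have "\<theta> j w0 = 0"
        by (simp add: \<theta>_def im0 blinfun.zero_right)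
      ultimately have "s w0 $ j = of_real (cmod (z0 $ j)) * sgn (z0 $ j)"
        using nz[of j] by (simp add: s_def exp_of_real)
      then show ?thesis
        using nz[of j] by (simp add: sgn_div_norm scaleR_conv_of_real)
    qed
    then have "s w0 = z0"
      by (simp add: vec_eq_iff)
    with hp w0 show thesis
      by (rule that)
  qed
qed

end

section \<open>The reduced Kaehler form\<close>

context toric_data begin

text \<open>
  The value computed by means of a parametrization is the same for all of them, and by
  \<open>hol_param_exists\<close> there is one around the given point, whose differential attains all tangent
  vectors.
\<close>

theorem kaehler_form_eq_ddbar:
  assumes p: "p \<in> M_open L u lam" and a: "a \<in> M_tangent L u p" and b: "b \<in> M_tangent L u p"
  shows "omega_red L u lam a b = \<i> * M_ddbar L u lam (kaehler_potential u lam \<circ> moment_P u lam) a b"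
proof -
  have ddbar_eq: "ddbar (\<lambda>w'. (kaehler_potential u lam \<circ> moment_P u lam) (orbit_proj L u (s w'))) w x y = - \<i> * omega_red L u lam a b"
    if hp: "hol_param L u lam U s" and w: "w \<in> U"
      and a: "a = d_proj L u (s w) (frechet_derivative s (at w) x)"
      and b: "b = d_proj L u (s w) (frechet_derivative s (at w) y)" for U s w x y
  proof -
    note props = hol_param_lift_properties[OF hp w]
    have "omega_red L u lam a b = \<i> * ddbar (\<lambda>w'. (kaehler_potential u lam \<circ> moment_P u lam) (orbit_proj L u (s w'))) w x y"
      unfolding a b omega_red_d_proj[OF props(2,3,4,4)] by (rule hol_param_ddbar[OF hp w, symmetric])
    then show ?thesis
      by (simp flip: mult.assoc)
  qed
  obtain z where z: "z \<in> level_set u lam" and p_eq: "p = orbit_proj L u z" and nz: "\<And>j. z $ j \<noteq> 0"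
    using p by (auto simp: mem_M_open)
  obtain U s w where hp: "hol_param L u lam U s" and w: "w \<in> U" and sw: "s w = z"
    using hol_param_exists[OF z nz] by metis
  have "bij_betw (\<lambda>x. d_proj L u (s w) (frechet_derivative s (at w) x)) UNIV (M_tangent L u p)"
    unfolding p_eq sw[symmetric] using hp w unfolding hol_param_def by blast
  then have "M_tangent L u p = range (\<lambda>x. d_proj L u (s w) (frechet_derivative s (at w) x))"
    by (simp add: bij_betw_def)
  then obtain x y where x: "a = d_proj L u (s w) (frechet_derivative s (at w) x)"
    and y: "b = d_proj L u (s w) (frechet_derivative s (at w) y)"
    using a b by auto
  have "M_ddbar L u lam (kaehler_potential u lam \<circ> moment_P u lam) a b = - \<i> * omega_red L u lam a b"
    unfolding M_ddbar_def
  proof (rule the_equality)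
    show "\<exists>U s. hol_param L u lam U s \<and> (\<exists>w\<in>U. \<exists>x y.
        a = d_proj L u (s w) (frechet_derivative s (at w) x) \<and>
        b = d_proj L u (s w) (frechet_derivative s (at w) y) \<and>
        - \<i> * omega_red L u lam a b = ddbar (\<lambda>w'. (kaehler_potential u lam \<circ> moment_P u lam) (orbit_proj L u (s w'))) w x y)"
      by (rule exI[of _ U], rule exI[of _ s], rule conjI[OF hp], rule bexI[OF _ w], rule exI[of _ x], rule exI[of _ y])
         (intro conjI x y ddbar_eq[OF hp w x y, symmetric])
  next
    fix r assume "\<exists>U s. hol_param L u lam U s \<and> (\<exists>w\<in>U. \<exists>x y.
        a = d_proj L u (s w) (frechet_derivative s (at w) x) \<and>
        b = d_proj L u (s w) (frechet_derivative s (at w) y) \<and>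
        r = ddbar (\<lambda>w'. (kaehler_potential u lam \<circ> moment_P u lam) (orbit_proj L u (s w'))) w x y)"
    then show "r = - \<i> * omega_red L u lam a b"
      by (elim exE conjE bexE) (simp only: ddbar_eq)
  qed
  then show ?thesis
    by (simp flip: mult.assoc)
qed

end

theorem theorem4p4:
  fixes Z_G :: "(real ^ 'd) set"
    and u :: "'n::finite \<Rightarrow> real ^ 'd"
    and lam :: "'n \<Rightarrow> real"
  assumes "is_lattice Z_G"
    and "\<And>j. primitive_in Z_G (u j)"
    and "span (range u) = UNIV"
    and "interior (polyhedron_of u lam) \<noteq> {}"
    and "\<And>i. polyhedron_of u lam \<subset>
               {\<eta> :: (real ^ 'd) \<Rightarrow>\<^sub>L real. \<forall>j. j \<noteq> i \<longrightarrow> blinfun_apply \<eta> (u j) - lam j \<ge> 0}"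
  shows "\<forall>p\<in>M_open Z_G u lam. \<forall>a\<in>M_tangent Z_G u p. \<forall>b\<in>M_tangent Z_G u p.
           omega_red Z_G u lam a b =
             \<i> * M_ddbar Z_G u lam
                   ((\<lambda>\<eta>. complex_of_real (\<Sum>j\<in>UNIV.
                        lam j * ln (blinfun_apply \<eta> (u j) - lam j) + blinfun_apply \<eta> (u j)))
                    \<circ> moment_P u lam)
                   a b"
proof -
  interpret toric_data Z_G u
    using assms(1-3) by unfold_locales (auto simp: primitive_in_def)
  show ?thesis
    using kaehler_form_eq_ddbar unfolding kaehler_potential_def by blast
qed

end
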